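(* Let $G$ be a connected subcubic graph with $n$ vertices and $h$ bridges, and let $s$ be the number of vertices incident to more than one bridge. Then a graph-TSP tour of $G$ of length at most $\frac{4}{3}(n+h)-\frac{2}{3}(s+1)$ can be constructed.
   Context: Subcubic: every vertex has degree at most 3. A bridge is an edge whose removal disconnects the graph. A graph-TSP tour of length $L$ in a connected graph $G$ is a Hamiltonian cycle of cost $L$ in the metric completion of $G$ (complete graph on the vertices with cost equal to shortest-path distance in $G$); equivalently, a spanning Eulerian multi-subgraph of $G$ (connected, using copies of edges of $G$, all degrees even) with $L$ edges. *)

theory Defs
  imports Complex_Main
begin

definition simple_graph :: "'a set \<Rightarrow> 'a set set \<Rightarrow> bool" where
  "simple_graph V E \<longleftrightarrow>
     finite V \<and> (\<forall>e\<in>E. \<exists>u\<in>V. \<exists>v\<in>V. u \<noteq> v \<and> e = {u, v})"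

definition adj_rel :: "'a set set \<Rightarrow> ('a \<times> 'a) set" where
  "adj_rel E = {(u, v). {u, v} \<in> E}"

text \<open>The null graph does not count as connected.\<close>

definition connected_graph :: "'a set \<Rightarrow> 'a set set \<Rightarrow> bool" where
  "connected_graph V E \<longleftrightarrow>
     V \<noteq> {} \<and> (\<forall>u\<in>V. \<forall>v\<in>V. (u, v) \<in> (adj_rel E)\<^sup>*)"

definition degree :: "'a set set \<Rightarrow> 'a \<Rightarrow> nat" where
  "degree E v = card {e \<in> E. v \<in> e}"

definition subcubic :: "'a set \<Rightarrow> 'a set set \<Rightarrow> bool" where
  "subcubic V E \<longleftrightarrow> (\<forall>v\<in>V. degree E v \<le> 3)"

definition bridges :: "'a set \<Rightarrow> 'a set set \<Rightarrow> 'a set set" where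
  "bridges V E = {e \<in> E. \<not> connected_graph V (E - {e})}"

text \<open>Shortest-path distance, i.e. the least number of edges of a walk from
  \<open>u\<close> to \<open>v\<close>. It is meaningful only if such a walk exists.\<close>

definition graph_dist :: "'a set set \<Rightarrow> 'a \<Rightarrow> 'a \<Rightarrow> nat" where
  "graph_dist E u v = (LEAST k. (u, v) \<in> adj_rel E ^^ k)"

text \<open>A Hamiltonian cycle of the complete graph on \<open>V\<close> is given by a list that
  enumerates \<open>V\<close> without repetition and is read cyclically: the last vertex is
  followed by the first one. This includes the degenerate cases of one vertex
  (cost 0) and of two vertices (the edge is traversed back and forth).\<close>

definition hamiltonian_cycle_complete :: "'a set \<Rightarrow> 'a list \<Rightarrow> bool" where
  "hamiltonian_cycle_complete V xs \<longleftrightarrow> distinct xs \<and> set xs = V"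

definition cycle_cost :: "('a \<Rightarrow> 'a \<Rightarrow> nat) \<Rightarrow> 'a list \<Rightarrow> nat" where
  "cycle_cost c xs = (\<Sum>i<length xs. c (xs ! i) (xs ! (Suc i mod length xs)))"

text \<open>A tour of length \<open>L\<close> is a Hamiltonian cycle of cost \<open>L\<close> in the metric
  completion of the graph.\<close>

definition graph_tsp_tour :: "'a set \<Rightarrow> 'a set set \<Rightarrow> 'a list \<Rightarrow> nat \<Rightarrow> bool" where
  "graph_tsp_tour V E xs L \<longleftrightarrow>
     hamiltonian_cycle_complete V xs \<and> cycle_cost (graph_dist E) xs = L"

end

theory Submission
  imports Defs "HOL-Library.Multiset" "HOL-Library.Sublist"
begin

text \<open>Following Moemke and Svensson, start from the whole edge set, with bridges doubled, and correct
  the parities by a set \<open>F\<close> of non-bridges that contains exactly one edge at each vertex with three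
  non-bridges. An edge of \<open>F\<close> is normally doubled, but a removable one is deleted instead.

  The removable edges come from a depth-first search tree. If a back edge ends in a vertex \<open>v\<close>, it
  forms a pair with the tree edge from \<open>v\<close> towards the other end of the back edge, and deleting at
  most one edge of each pair keeps the graph connected. When \<open>v\<close> has three non-bridges, both edges
  of the pair are removable because \<open>F\<close> uses only one edge at \<open>v\<close>; otherwise only one of them is
  chosen. In addition one non-bridge \<open>e\<close> is taken out beforehand and is removable as well.

  Weighting removable edges by \<open>-1\<close> and the others by \<open>1\<close>, Edmonds' description of the perfect
  matching polytope yields an \<open>F\<close> of weight at most a third of the total weight. The parent edges of
  the vertices with only one chosen edge, and of the vertices on more than one bridge, are distinct
  bridges; this gives the correction terms in \<open>h\<close> and \<open>s\<close>.\<close>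

text \<open>The constants balance as follows. The multigraph has
  \<open>card H + sum w F + 2 * h\<close> edges, where \<open>H\<close> is the set of non-bridges
  and \<open>R\<close> the set of removable edges; this is at most
  \<open>4/3 * card H - 2/3 * card R + 2 * h\<close>. Once \<open>e\<close> is taken out, the search
  tree leaves one back edge per pair, so \<open>card H\<close> is \<open>n - h\<close> plus the
  number of pairs. A pair thus costs 4/3 and earns 2/3 per removable edge: it breaks even with two
  of them and loses 2/3 with one. A bridge costs 2/3 net while the bound grants 4/3, so it has 2/3
  to give away, to a losing pair or to a vertex counted by \<open>s\<close>.

  The obstacle is Edmonds' theorem, obtained here by induction without extreme points: a point is
  moved along a kernel vector of the degree equations until an edge vanishes or an odd set becomes
  tight, and a tight set splits the graph into two contractions. Counting yields a kernel vector
  once all degrees are at least 3; smaller degrees are treated by hand.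

  Cuts replace paths throughout, because joining, contracting and being a bridge are all statements
  about cuts. Contraction creates parallel edges, hence edges are names with an \<open>ends\<close>
  function.\<close>

section \<open>Edge cuts and connectivity\<close>

definition ecut :: "('e \<Rightarrow> 'v set) \<Rightarrow> 'e set \<Rightarrow> 'v set \<Rightarrow> 'e set" where
  "ecut ends E U = {e \<in> E. ends e \<inter> U \<noteq> {} \<and> \<not> ends e \<subseteq> U}"

abbreviation bd :: "'a set set \<Rightarrow> 'a set \<Rightarrow> 'a set set" where
  "bd E U \<equiv> ecut (\<lambda>e. e) E U"

text \<open>Connectivity as the absence of an empty cut. It holds vacuously for at most one vertex,
  and for the empty set too, unlike \<open>connected_graph\<close>.\<close>

definition conn :: "'a set \<Rightarrow> 'a set set \<Rightarrow> bool" where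
  "conn S F \<longleftrightarrow> (\<forall>W. W \<noteq> {} \<longrightarrow> W \<subset> S \<longrightarrow> bd F W \<noteq> {})"

lemma card_2_obtain:
  assumes "card e = 2" "x \<in> e"
  obtains z where "z \<noteq> x" "e = {x, z}"
  using assms by (metis card_2_iff doubleton_eq_iff insert_iff singletonD)

lemma adj_rel_rtrancl_cut:
  assumes "(u, v) \<in> (adj_rel E)\<^sup>*" "u \<in> W" "v \<notin> W"
  shows "bd E W \<noteq> {}"
  using assms
proof (induction rule: rtrancl_induct)
  case (step y z)
  show ?case
  proof (cases "y \<in> W")
    case True
    then have "{y, z} \<in> bd E W"
      using step by (auto simp: adj_rel_def ecut_def)
    then show ?thesis by auto
  qed (use step in auto)
qed auto

lemma connected_graph_iff_conn:
  assumes "\<forall>e\<in>E. e \<subseteq> V \<and> card e = 2"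
  shows "connected_graph V E \<longleftrightarrow> V \<noteq> {} \<and> conn V E"
proof
  assume c: "connected_graph V E"
  have "bd E W \<noteq> {}" if W: "W \<noteq> {}" "W \<subset> V" for W
  proof -
    obtain u v where uv: "u \<in> W" "v \<in> V" "v \<notin> W" using W by blast
    moreover have "(u, v) \<in> (adj_rel E)\<^sup>*"
      using c uv W by (auto simp: connected_graph_def)
    ultimately show ?thesis using adj_rel_rtrancl_cut by metis
  qed
  then show "V \<noteq> {} \<and> conn V E"
    using c by (auto simp: connected_graph_def conn_def)
next
  assume c: "V \<noteq> {} \<and> conn V E"
  have "(u, v) \<in> (adj_rel E)\<^sup>*" if uv: "u \<in> V" "v \<in> V" for u v
  proof (rule ccontr)
    assume n: "(u, v) \<notin> (adj_rel E)\<^sup>*"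
    define W where "W = {w \<in> V. (u, w) \<in> (adj_rel E)\<^sup>*}"
    have "W \<noteq> {}" "W \<subset> V" using uv n by (auto simp: W_def)
    then have "bd E W \<noteq> {}" using c by (auto simp: conn_def)
    then obtain e a b where e: "e \<in> E" "a \<in> e" "a \<in> W" "b \<in> e" "b \<notin> W"
      by (auto simp: ecut_def)
    then have "a \<noteq> b" by auto
    then have "e = {a, b}"
      using assms e by (auto simp: card_2_iff)
    then have "(a, b) \<in> adj_rel E" "b \<in> V"
      using e assms by (auto simp: adj_rel_def)
    then have "b \<in> W" using e(3) by (auto simp: W_def)
    then show False using e by simp
  qed
  then show "connected_graph V E"
    using c by (auto simp: connected_graph_def)
qed

subsection \<open>Eulerian multigraphs\<close>

fun walk_edges :: "'a list \<Rightarrow> 'a set multiset" where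
  "walk_edges (x # y # xs) = add_mset {x, y} (walk_edges (y # xs))"
| "walk_edges _ = {#}"

lemma walk_edges_append:
  "walk_edges (xs @ a # ys) = walk_edges (xs @ [a]) + walk_edges (a # ys)"
  by (induction xs rule: walk_edges.induct) auto

lemma walk_edges_subset: "e \<in># walk_edges xs \<Longrightarrow> e \<subseteq> set xs"
  by (induction xs rule: walk_edges.induct) auto

lemma size_walk_edges: "size (walk_edges xs) = length xs - 1"
  by (induction xs rule: walk_edges.induct) auto

definition mdeg :: "'a set multiset \<Rightarrow> 'a \<Rightarrow> nat" where
  "mdeg N v = size (filter_mset (\<lambda>e. v \<in> e) N)"

lemma mdeg_diff: "A \<subseteq># N \<Longrightarrow> mdeg (N - A) v = mdeg N v - mdeg A v"
  by (simp add: mdeg_def size_Diff_submset multiset_filter_mono)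

lemma mdeg_mono: "A \<subseteq># N \<Longrightarrow> mdeg A v \<le> mdeg N v"
  by (simp add: mdeg_def size_mset_mono multiset_filter_mono)

text \<open>Each passage through \<open>v\<close> uses two edges at \<open>v\<close>, so only the
  two ends of the walk can have odd degree. A step from \<open>x\<close> to \<open>x\<close> would
  break this, as \<open>{x, x}\<close> counts once; \<open>card e = 2\<close> excludes it.\<close>

lemma even_mdeg_walk:
  assumes "xs \<noteq> []" "\<forall>e \<in># walk_edges xs. card e = 2"
  shows "even (mdeg (walk_edges xs) v) \<longleftrightarrow> (hd xs = v \<longleftrightarrow> last xs = v)"
  using assms
proof (induction xs rule: walk_edges.induct)
  case (1 x y xs)
  then have "x \<noteq> y" by auto
  then show ?case using 1 by (auto simp: mdeg_def)
qed (auto simp: mdeg_def)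

lemma even_close_walk:
  assumes "\<forall>v. even (mdeg N v)" "\<forall>e \<in># N. card e = 2"
    and "xs \<noteq> []" "walk_edges xs \<subseteq># N"
  shows "\<exists>ys. walk_edges (xs @ ys) \<subseteq># N \<and> last (xs @ ys) = hd xs"
  using assms(3,4)
proof (induction "size N - size (walk_edges xs)" arbitrary: xs rule: less_induct)
  case less
  show ?case
  proof (cases "last xs = hd xs")
    case True
    then show ?thesis using less by (intro exI[of _ "[]"]) auto
  next
    case False
    let ?W = "walk_edges xs" and ?x = "last xs"
    have "\<forall>e \<in># ?W. card e = 2" using less(3) assms(2) by (meson mset_subset_eqD)
    then have "odd (mdeg ?W ?x)"
      using even_mdeg_walk[OF less(2)] False by metis
    then have "odd (mdeg (N - ?W) ?x)"
      using assms(1) mdeg_mono[OF less(3), of ?x] by (simp add: mdeg_diff less(3) linorder_not_less)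
    then have "filter_mset (\<lambda>e. ?x \<in> e) (N - ?W) \<noteq> {#}"
      by (auto simp: mdeg_def)
    then obtain e where "e \<in># filter_mset (\<lambda>e. ?x \<in> e) (N - ?W)"
      by (rule multiset_nonemptyE)
    then have e: "e \<in># N - ?W" "?x \<in> e"
      by (simp_all only: set_mset_filter mem_Collect_eq)
    have "e \<in># N" using e(1) by (rule in_diffD)
    then obtain z where z: "e = {?x, z}" using card_2_obtain[of e ?x] assms(2) e(2) by blast
    have xs: "butlast xs @ ?x # zs = xs @ zs" for zs using less(2) by simp
    have we: "walk_edges (xs @ [z]) = add_mset e ?W"
      using walk_edges_append[of "butlast xs" ?x "[z]"] less(2) z by (simp add: xs)
    have sub: "walk_edges (xs @ [z]) \<subseteq># N"
    proof -
      have "{#e#} + ?W \<subseteq># N"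
        using e(1) by (simp only: subset_mset.le_diff_conv2[OF less(3), symmetric] single_subset_iff)
      then show ?thesis by (simp add: we)
    qed
    have "size (walk_edges (xs @ [z])) \<le> size N" using sub by (rule size_mset_mono)
    then have "size N - size (walk_edges (xs @ [z])) < size N - size ?W"
      by (simp add: we)
    from less(1)[OF this _ sub] obtain ys where
      "walk_edges ((xs @ [z]) @ ys) \<subseteq># N" "last ((xs @ [z]) @ ys) = hd (xs @ [z])"
      by auto
    then show ?thesis using less(2) by (intro exI[of _ "z # ys"]) auto
  qed
qed

lemma even_connected_closed_walk:
  assumes even: "\<forall>v. even (mdeg N v)" and N2: "\<forall>e \<in># N. card e = 2 \<and> e \<subseteq> V"
    and "V \<noteq> {}" and con: "conn V (set_mset N)"
  shows "\<exists>xs. xs \<noteq> [] \<and> hd xs = last xs \<and> set xs = V \<and> walk_edges xs \<subseteq># N"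
proof -
  define P where "P xs \<longleftrightarrow> xs \<noteq> [] \<and> hd xs = last xs \<and> set xs \<subseteq> V \<and> walk_edges xs \<subseteq># N" for xs
  obtain v0 where "v0 \<in> V" using assms by auto
  then have "P [v0]" by (auto simp: P_def)
  moreover have "\<forall>xs. P xs \<longrightarrow> length xs < size N + 2"
  proof (intro allI impI)
    fix xs assume "P xs"
    then have "size (walk_edges xs) \<le> size N" by (auto simp: P_def intro: size_mset_mono)
    then show "length xs < size N + 2" by (simp add: size_walk_edges)
  qed
  ultimately obtain c where c: "P c" and max: "\<And>xs. P xs \<Longrightarrow> length xs \<le> length c"
    using ex_has_greatest_nat[of P "[v0]" length "size N + 2"] by (metis less_imp_le)
  have "set c = V"
  proof (rule ccontr)
    assume "set c \<noteq> V"
    then have "bd (set_mset N) (set c) \<noteq> {}"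
      using con c by (auto simp: conn_def P_def)
    then obtain e a b where e: "e \<in># N" "a \<in> e" "a \<in> set c" "b \<in> e" "b \<notin> set c"
      by (auto simp: ecut_def)
    then have "a \<noteq> b" by auto
    then have eab: "e = {a, b}" using N2 e by (auto simp: card_2_iff)
    have cN: "walk_edges c \<subseteq># N" using c by (simp add: P_def)
    have nin: "e \<notin># walk_edges c" using walk_edges_subset e by fastforce
    let ?N = "N - walk_edges c"
    have "\<forall>e \<in># walk_edges c. card e = 2" using cN N2 by (meson mset_subset_eqD)
    then have "even (mdeg (walk_edges c) v)" for v
      using even_mdeg_walk[of c v] c by (auto simp: P_def)
    then have ev: "\<forall>v. even (mdeg ?N v)"
      using even by (simp add: mdeg_diff cN)
    have "\<forall>e \<in># ?N. card e = 2" using N2 by (meson in_diffD)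
    moreover have "walk_edges [a, b] \<subseteq># ?N"
      using e(1) nin eab by (simp add: in_diff_count not_in_iff)
    ultimately obtain ys where ys: "walk_edges ([a, b] @ ys) \<subseteq># ?N"
      "last ([a, b] @ ys) = a"
      using even_close_walk[OF ev, of "[a, b]"] by auto
    obtain p q where pq: "c = p @ a # q" using e(3) by (meson split_list)
    let ?z = "a # b # ys"
    have "?z = butlast ?z @ [a]"
      using append_butlast_last_id[of ?z] ys(2) by (simp del: butlast.simps)
    then obtain z' where z': "?z = z' @ [a]" by metis
    \<comment> \<open>The detour from \<open>a\<close> back to \<open>a\<close> is inserted at one
      occurrence of \<open>a\<close>; \<open>z'\<close> omits its last vertex, which is the
      \<open>a\<close> already on the walk.\<close>
    let ?d = "p @ z' @ a # q"
    have "walk_edges ?d = walk_edges ((p @ z') @ [a]) + walk_edges (a # q)"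
      using walk_edges_append[of "p @ z'" a q] by simp
    also have "(p @ z') @ [a] = p @ a # b # ys" using z' by simp
    also have "walk_edges (p @ a # b # ys) = walk_edges (p @ [a]) + walk_edges ?z"
      by (rule walk_edges_append)
    finally have we: "walk_edges ?d = walk_edges c + walk_edges ?z"
      using walk_edges_append[of p a q] pq by simp
    have "walk_edges ?z \<subseteq># ?N" using ys(1) by (simp only: append_Cons append_Nil)
    then have "walk_edges ?z + walk_edges c \<subseteq># N"
      by (simp only: subset_mset.le_diff_conv2[OF cN])
    then have dN: "walk_edges ?d \<subseteq># N" by (simp only: we add.commute)
    have "set ?d \<subseteq> V"
    proof -
      have "set ?z \<subseteq> V"
      proof -
        have "walk_edges ?z \<subseteq># N" using dN we
          using mset_subset_eq_add_right subset_mset.order_trans by metis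
        then have *: "\<forall>e \<in># walk_edges ?z. e \<subseteq> V" using N2 by (meson mset_subset_eqD)
        have "set zs \<subseteq> V" if "\<forall>e \<in># walk_edges zs. e \<subseteq> V" "length zs \<ge> 2" for zs
          using that
        proof (induction zs rule: walk_edges.induct)
          case (1 x y xs)
          then show ?case by (cases xs) auto
        qed auto
        from this[OF *] show ?thesis by simp
      qed
      then have "set z' \<subseteq> V" using arg_cong[OF z', of set] by auto
      then show ?thesis using c pq by (auto simp: P_def)
    qed
    moreover have "hd ?d = last ?d"
    proof -
      have "hd (z' @ [a]) = a" using z' by (metis list.sel(1))
      then have "hd (z' @ a # q) = a" by (cases z') auto
      then have "hd ?d = hd c" using pq by (cases p) auto
      moreover have "last ?d = last c" using pq by simp
      ultimately show ?thesis using c by (simp add: P_def)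
    qed
    ultimately have "P ?d" using dN by (auto simp: P_def)
    moreover have "length z' > 0" using z' by (cases z') auto
    ultimately show False using max[of ?d] pq by simp
  qed
  then show ?thesis using c by (auto simp: P_def)
qed

subsection \<open>Shortcutting\<close>

fun path_cost :: "('a \<Rightarrow> 'a \<Rightarrow> nat) \<Rightarrow> 'a list \<Rightarrow> nat" where
  "path_cost c (x # y # xs) = c x y + path_cost c (y # xs)"
| "path_cost c _ = 0"

text \<open>The fixed ends \<open>a\<close> and \<open>b\<close> give every dropped vertex a
  neighbour on both sides, so that one triangle inequality pays for each drop.\<close>

lemma path_cost_subseq:
  assumes tri: "\<And>x y z. x \<in> V \<Longrightarrow> y \<in> V \<Longrightarrow> z \<in> V \<Longrightarrow> c x z \<le> c x y + c y z"
    and "subseq ys zs" "set zs \<subseteq> V" "a \<in> V" "b \<in> V"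
  shows "path_cost c (a # ys @ [b]) \<le> path_cost c (a # zs @ [b])"
  using assms(2-)
proof (induction arbitrary: a rule: list_emb.induct)
  case (list_emb_Nil ys)
  then show ?case
  proof (induction ys arbitrary: a)
    case (Cons y ys)
    have "c a b \<le> c a y + c y b" using Cons.prems by (intro tri) auto
    then show ?case using Cons.IH[of y] Cons.prems by auto
  qed auto
next
  case (list_emb_Cons xs ys y)
  have "path_cost c (a # xs @ [b]) \<le> c a y + path_cost c (y # xs @ [b])"
  proof (cases xs)
    case Nil
    then show ?thesis using tri[of a y b] list_emb_Cons.prems by simp
  next
    case (Cons x xs')
    have "x \<in> set ys"
      using list_emb_set[OF list_emb_Cons.hyps, of x] Cons by auto
    then have "c a x \<le> c a y + c y x"
      using list_emb_Cons.prems by (intro tri) auto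
    then show ?thesis using Cons by simp
  qed
  then show ?case using list_emb_Cons.IH[of y] list_emb_Cons.prems by simp
next
  case (list_emb_Cons2 x y xs ys)
  then show ?case using list_emb_Cons2.IH[of y] by simp
qed

lemma cycle_cost_eq_path_cost:
  "cycle_cost c (x # xs) = path_cost c ((x # xs) @ [x])"
proof -
  have path: "path_cost c ys = (\<Sum>i<length ys - 1. c (ys ! i) (ys ! Suc i))" for ys
    by (induction ys rule: walk_edges.induct) (auto simp: sum.lessThan_Suc_shift simp del: sum.lessThan_Suc)
  show ?thesis unfolding path cycle_cost_def
  proof (intro sum.cong)
    fix i assume "i \<in> {..<length ((x # xs) @ [x]) - 1}"
    then have "i < Suc (length xs)" by simp
    then have "(x # xs) ! i = ((x # xs) @ [x]) ! i" by (subst nth_append) simp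
    moreover have "i = length xs \<or> i < length xs" using \<open>i < Suc (length xs)\<close> by linarith
    ultimately show "c ((x # xs) ! i) ((x # xs) ! (Suc i mod length (x # xs)))
      = c (((x # xs) @ [x]) ! i) (((x # xs) @ [x]) ! Suc i)"
      by (auto simp: nth_append simp del: nth_Cons_Suc)
  qed simp
qed
lemma graph_dist_relpow:
  assumes "(u, v) \<in> (adj_rel E)\<^sup>*"
  shows "(u, v) \<in> adj_rel E ^^ graph_dist E u v"
  unfolding graph_dist_def using assms by (metis LeastI_ex rtrancl_imp_relpow)

lemma graph_dist_triangle:
  assumes "connected_graph V E" "x \<in> V" "y \<in> V" "z \<in> V"
  shows "graph_dist E x z \<le> graph_dist E x y + graph_dist E y z"
proof -
  have "(x, y) \<in> adj_rel E ^^ graph_dist E x y" "(y, z) \<in> adj_rel E ^^ graph_dist E y z"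
    using assms by (auto simp: connected_graph_def intro!: graph_dist_relpow)
  then have "(x, z) \<in> adj_rel E ^^ (graph_dist E x y + graph_dist E y z)"
    by (auto simp: relpow_add)
  then show ?thesis unfolding graph_dist_def[of E x z] by (rule Least_le)
qed

lemma graph_dist_edge: "{u, v} \<in> E \<Longrightarrow> graph_dist E u v \<le> 1"
  unfolding graph_dist_def by (rule Least_le) (auto simp: adj_rel_def)

lemma path_cost_graph_dist_walk:
  "\<forall>e \<in># walk_edges xs. e \<in> E \<Longrightarrow> path_cost (graph_dist E) xs \<le> size (walk_edges xs)"
proof (induction xs rule: walk_edges.induct)
  case (1 x y xs)
  then show ?case using graph_dist_edge[of x y E] by auto
qed auto

lemma tour_of_closed_walk:
  assumes con: "connected_graph V E" and ws: "ws \<noteq> []" "hd ws = last ws" "set ws = V"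
    and E: "\<forall>e \<in># walk_edges ws. e \<in> E"
  shows "\<exists>xs L. graph_tsp_tour V E xs L \<and> L \<le> size (walk_edges ws)"
proof -
  obtain v rest where vr: "ws = v # rest" using ws by (cases ws) auto
  show ?thesis
  proof (cases "rest = []")
    case True
    have "(v, v) \<in> adj_rel E ^^ 0" by simp
    then have "graph_dist E v v = 0" unfolding graph_dist_def by (simp add: Least_eq_0)
    then have "graph_tsp_tour V E [v] 0" 
      using ws vr True
      by (auto simp: graph_tsp_tour_def hamiltonian_cycle_complete_def cycle_cost_def)
    then show ?thesis by blast
  next
    case False
    then have rest: "rest = butlast rest @ [v]" using ws vr by simp
    let ?m = "butlast rest"
    \<comment> \<open>The start \<open>v\<close> is filtered out because the cycle already lists it
      at its head.\<close>
    define ys where "ys = remdups (filter (\<lambda>x. x \<noteq> v) ?m)"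
    have "subseq (remdups zs) zs" for zs :: "'a list"
      by (induction zs) (auto intro: subseq_Cons')
    then have sub: "subseq ys ?m"
      unfolding ys_def using subseq_filter_left subseq_order.order_trans by blast
    have setV: "set (v # ?m) = V" using ws(3) vr rest
      by (metis Un_insert_right append_Nil2 insert_absorb2 list.simps(15) list.set(1) set_append)
    then have "set (v # ys) = V" "distinct (v # ys)" by (auto simp: ys_def)
    then have ham: "hamiltonian_cycle_complete V (v # ys)"
      by (simp add: hamiltonian_cycle_complete_def)
    have "cycle_cost (graph_dist E) (v # ys) = path_cost (graph_dist E) (v # ys @ [v])"
      by (simp only: cycle_cost_eq_path_cost append_Cons)
    also have "\<dots> \<le> path_cost (graph_dist E) (v # ?m @ [v])"
      using setV by (intro path_cost_subseq[of V] graph_dist_triangle[OF con] sub) auto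
    also have "v # ?m @ [v] = ws" using rest vr by simp
    also have "path_cost (graph_dist E) ws \<le> size (walk_edges ws)"
      using E by (rule path_cost_graph_dist_walk)
    finally show ?thesis using ham by (auto simp: graph_tsp_tour_def)
  qed
qed

lemma tour_of_even_multigraph:
  assumes con: "connected_graph V E" and N: "\<forall>e \<in># N. e \<in> E"
    and E: "\<forall>e \<in> E. card e = 2 \<and> e \<subseteq> V"
    and "\<forall>v. even (mdeg N v)" "conn V (set_mset N)"
  shows "\<exists>xs L. graph_tsp_tour V E xs L \<and> L \<le> size N"
proof -
  have "V \<noteq> {}" using con by (simp add: connected_graph_def)
  then obtain ws where ws: "ws \<noteq> []" "hd ws = last ws" "set ws = V" "walk_edges ws \<subseteq># N"
    using even_connected_closed_walk[of N V] assms by metis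
  then have "\<forall>e \<in># walk_edges ws. e \<in> E" using N by (meson mset_subset_eqD)
  from tour_of_closed_walk[OF con ws(1-3) this] show ?thesis
    using size_mset_mono[OF ws(4)] le_trans by blast
qed

subsection \<open>Removable pairings\<close>

abbreviation induced :: "'a set set \<Rightarrow> 'a set \<Rightarrow> 'a set set" where
  "induced E S \<equiv> {e \<in> E. e \<subseteq> S}"

text \<open>A set \<open>W\<close> that splits neither \<open>A\<close> nor \<open>B\<close>
  contains one of them and misses the other, so \<open>e\<close> itself crosses.\<close>

lemma conn_join:
  assumes "conn A (induced F A)" "conn B (induced F B)" "e \<in> F" "e \<subseteq> A \<union> B" "e \<inter> A \<noteq> {}" "e \<inter> B \<noteq> {}"
  shows "conn (A \<union> B) (induced F (A \<union> B))"
  unfolding conn_def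
proof (intro allI impI)
  fix W assume W: "W \<noteq> {}" "W \<subset> A \<union> B"
  have *: "bd (induced F (A \<union> B)) W \<noteq> {}"
    if "conn S (induced F S)" "S \<subseteq> A \<union> B" "W \<inter> S \<noteq> {}" "\<not> S \<subseteq> W" for S
  proof -
    have "W \<inter> S \<subset> S" using that by auto
    then have "bd (induced F S) (W \<inter> S) \<noteq> {}" using that by (simp add: conn_def)
    then show ?thesis using that by (auto simp: ecut_def)
  qed
  show "bd (induced F (A \<union> B)) W \<noteq> {}"
  proof (cases "(W \<inter> A \<noteq> {} \<and> \<not> A \<subseteq> W) \<or> (W \<inter> B \<noteq> {} \<and> \<not> B \<subseteq> W)")
    case True
    then show ?thesis using *[of A] *[of B] assms by blast
  next
    case False
    then have "e \<in> bd (induced F (A \<union> B)) W"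
      using W assms(3-6) by (auto simp: ecut_def)
    then show ?thesis by blast
  qed
qed

text \<open>\<open>Q\<close> collects the vertices of a depth-first search tree rooted at \<open>r\<close> at which a back edge
  ends; \<open>p v\<close> consists of this back edge and the tree edge from \<open>v\<close> to the child whose subtree
  contains the other end, and \<open>par v\<close> is the tree edge from \<open>v\<close> to its parent.\<close>

definition removable_pairing ::
  "'a set set \<Rightarrow> 'a set \<Rightarrow> 'a \<Rightarrow> 'a set \<Rightarrow> ('a \<Rightarrow> 'a set set) \<Rightarrow> ('a \<Rightarrow> 'a set) \<Rightarrow> bool" where
  "removable_pairing E S r Q p par \<longleftrightarrow>
     Q \<subseteq> S \<and>
     (\<forall>v\<in>Q. p v \<subseteq> {e \<in> induced E S. v \<in> e} \<and> card (p v) = 2) \<and>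
     (\<forall>v\<in>Q. \<forall>w\<in>Q. v \<noteq> w \<longrightarrow> p v \<inter> p w = {}) \<and>
     card (induced E S) + 1 = card S + card Q \<and>
     inj_on par (S - {r}) \<and>
     (\<forall>v\<in>S - {r}. par v \<in> induced E S \<and> v \<in> par v \<and> (v \<in> Q \<longrightarrow> par v \<notin> p v)) \<and>
     (\<forall>D. (\<forall>v\<in>Q. \<not> p v \<subseteq> D) \<longrightarrow> D \<subseteq> \<Union> (p ` Q) \<longrightarrow> conn S (induced (E - D) S))"

text \<open>A smallest nonempty set that no edge avoiding \<open>r\<close> leaves is connected: an
  empty cut inside it would give a smaller such set.\<close>

lemma component_exists:
  assumes "finite S" "r \<in> S" "S \<noteq> {r}"
  obtains C where "C \<noteq> {}" "C \<subseteq> S - {r}" "bd (induced E (S - {r})) C = {}" "conn C (induced E C)"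
proof -
  define P where "P C \<longleftrightarrow> C \<noteq> {} \<and> C \<subseteq> S - {r} \<and> bd (induced E (S - {r})) C = {}" for C
  have "P (S - {r})" using assms by (auto simp: P_def ecut_def)
  then obtain C where C: "P C" and min: "\<And>D. P D \<Longrightarrow> card C \<le> card D"
    using ex_has_least_nat[of P _ card] by metis
  have "finite C" using C assms(1) by (meson P_def finite_Diff finite_subset)
  have "conn C (induced E C)"
    unfolding conn_def
  proof (intro allI impI notI)
    fix W assume W: "W \<noteq> {}" "W \<subset> C" "bd (induced E C) W = {}"
    have "bd (induced E (S - {r})) W = {}"
    proof (rule ccontr)
      assume "bd (induced E (S - {r})) W \<noteq> {}"
      then obtain e where e: "e \<in> E" "e \<subseteq> S - {r}" "e \<inter> W \<noteq> {}" "\<not> e \<subseteq> W"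
        by (auto simp: ecut_def)
      have "e \<inter> C \<noteq> {}" using e(3) W(2) by blast
      have "e \<notin> bd (induced E (S - {r})) C" using C by (simp add: P_def)
      then have "e \<subseteq> C" using e(1,2) \<open>e \<inter> C \<noteq> {}\<close> by (simp add: ecut_def)
      then have "e \<in> bd (induced E C) W" using e by (simp add: ecut_def)
      then show False using W(3) by simp
    qed
    then have "P W" using W C by (auto simp: P_def)
    then show False using min[of W] psubset_card_mono[OF \<open>finite C\<close> W(2)] by simp
  qed
  then show ?thesis using that C by (auto simp: P_def)
qed

text \<open>The recursion builds the search tree implicitly. A component \<open>C\<close> of
  \<open>S - {r}\<close> becomes the subtree of a child \<open>c\<close>, and \<open>T\<close>,
  which keeps \<open>r\<close> as its root, holds the other subtrees. The set \<open>X\<close> of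
  edges from \<open>r\<close> to \<open>C\<close> is the tree edge, possibly with one back edge. The
  bound 2 on the degree of the root is what allows at most one back edge per vertex; it is inherited
  by \<open>c\<close>, which loses \<open>e0\<close> out of at most three edges.\<close>

lemma removable_pairing_exists:
  fixes E :: "'a set set"
  assumes finE: "finite E" and E2: "\<And>e. e \<in> E \<Longrightarrow> card e = 2"
    and deg: "\<And>v. card {e \<in> E. v \<in> e} \<le> 3"
    and "finite S" "r \<in> S" "card {e \<in> induced E S. r \<in> e} \<le> 2" "conn S (induced E S)"
  shows "\<exists>Q p par. removable_pairing E S r Q p par"
  using assms(4-)
proof (induction "card S" arbitrary: S r rule: less_induct)
  case less
  note finS = less(2) and rS = less(3) and degr = less(4) and conS = less(5)
  show ?case
  proof (cases "S = {r}")
    case True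
    have "induced E S = {}"
    proof (rule ccontr)
      assume "induced E S \<noteq> {}"
      then obtain e where "e \<in> E" "e \<subseteq> {r}" using True by auto
      then show False using E2[of e] card_mono[of "{r}" e] by simp
    qed
    moreover have "conn S F" for F using True by (auto simp: conn_def)
    ultimately have "removable_pairing E S r {} undefined undefined"
      using True by (simp add: removable_pairing_def)
    then show ?thesis by blast
  next
    case False
    obtain C where C: "C \<noteq> {}" "C \<subseteq> S - {r}" "bd (induced E (S - {r})) C = {}" "conn C (induced E C)"
      using component_exists[OF finS rS False] by blast
    have closed: "e \<subseteq> C" if "e \<in> E" "e \<subseteq> S" "r \<notin> e" "e \<inter> C \<noteq> {}" for e
      using C(3) that by (auto simp: ecut_def)
    define X where "X = {e \<in> induced E S. r \<in> e \<and> e \<inter> C \<noteq> {}}"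
    define T where "T = S - C"
    have T: "r \<in> T" "T \<subseteq> S" "C \<inter> T = {}" "C \<union> T = S" "finite T" "finite C"
      using rS C finS finite_subset[of C S] by (auto simp: T_def)
    have Tless: "card T < card S" "card C < card S"
      using C T finS by (auto intro!: psubset_card_mono)
    have Xne: "X \<noteq> {}"
    proof -
      have "C \<subset> S" using C rS by auto
      then have "bd (induced E S) C \<noteq> {}" using conS C(1) by (simp add: conn_def)
      then obtain e where "e \<in> E" "e \<subseteq> S" "e \<inter> C \<noteq> {}" "\<not> e \<subseteq> C" by (auto simp: ecut_def)
      then have "e \<in> X" using closed by (auto simp: X_def)
      then show ?thesis by auto
    qed
    then obtain e0 where e0: "e0 \<in> X" by auto
    then obtain c where c: "c \<in> C" "c \<in> e0" by (auto simp: X_def)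
    then have cr: "c \<noteq> r" using C by auto
    have e0': "e0 \<in> E" "e0 \<subseteq> S" "r \<in> e0" using e0 by (auto simp: X_def)
    have Eeq: "induced E S = induced E C \<union> induced E T \<union> X"
    proof
      show "induced E S \<subseteq> induced E C \<union> induced E T \<union> X"
      proof
        fix e assume e: "e \<in> induced E S"
        show "e \<in> induced E C \<union> induced E T \<union> X"
        proof (cases "e \<inter> C = {} \<or> r \<in> e")
          case True
          then show ?thesis using e T(4) by (auto simp: X_def)
        next
          case False
          then show ?thesis using e closed[of e] by simp
        qed
      qed
      show "induced E C \<union> induced E T \<union> X \<subseteq> induced E S" using T(2,4) by (auto simp: X_def)
    qed
    have disj: "induced E C \<inter> induced E T = {}" "induced E C \<inter> X = {}" "induced E T \<inter> X = {}"
    proof -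
      show "induced E C \<inter> X = {}" "induced E T \<inter> X = {}" using T by (auto simp: X_def)
      have "False" if "e \<in> E" "e \<subseteq> C" "e \<subseteq> T" for e
      proof -
        have "e = {}" using that T(3) by blast
        then show False using E2[OF that(1)] by simp
      qed
      then show "induced E C \<inter> induced E T = {}" by blast
    qed
    \<comment> \<open>\<open>C\<close> is attached to the rest only through \<open>r\<close>, so a
      cut of \<open>T\<close> becomes a cut of \<open>S\<close> by putting \<open>C\<close> on the
      side of \<open>r\<close>.\<close>
    have conT: "conn T (induced E T)"
      unfolding conn_def
    proof (intro allI impI)
      fix W assume W: "W \<noteq> {}" "W \<subset> T"
      define W' where "W' = (if r \<in> W then W \<union> C else W)"
      have "W' \<noteq> {}" "W' \<subset> S" using W T C(1) by (auto simp: W'_def)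
      then have "bd (induced E S) W' \<noteq> {}" using conS by (simp add: conn_def)
      then obtain e a b where e: "e \<in> E" "e \<subseteq> S" "a \<in> e" "b \<in> e" "a \<in> W'" "b \<notin> W'"
        by (auto simp: ecut_def)
      have eab: "e = {a, b}"
        using E2[OF e(1)] card_2_obtain[of e a] e(3-6) by blast
      have "e \<inter> C = {}"
      proof (rule ccontr)
        assume "e \<inter> C \<noteq> {}"
        then have "r \<in> e \<or> e \<subseteq> C" using closed e by blast
        moreover have "r \<in> W' \<Longrightarrow> C \<subseteq> W'" "r \<notin> W' \<Longrightarrow> C \<inter> W' = {}"
          using W T C(2) by (auto simp: W'_def)
        ultimately show False using e(5,6) eab C(2) \<open>e \<inter> C \<noteq> {}\<close> by auto
      qed
      then have "e \<in> bd (induced E T) W"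
        using e T(4) by (auto simp: ecut_def W'_def split: if_splits)
      then show "bd (induced E T) W \<noteq> {}" by blast
    qed
    have degC: "card {e \<in> induced E C. c \<in> e} \<le> 2"
    proof -
      have "insert e0 {e \<in> induced E C. c \<in> e} \<subseteq> {e \<in> E. c \<in> e}" using e0' c by auto
      then have "card (insert e0 {e \<in> induced E C. c \<in> e}) \<le> card {e \<in> E. c \<in> e}"
        using finE by (intro card_mono) auto
      moreover have "e0 \<notin> {e \<in> induced E C. c \<in> e}" using e0' C by auto
      ultimately show ?thesis using deg[of c] finE by simp
    qed
    have fin_ind: "finite (induced E A)" for A using finE by auto
    have sub_r: "{e \<in> induced E T. r \<in> e} \<union> X \<subseteq> {e \<in> induced E S. r \<in> e}"
      using T by (auto simp: X_def)
    then have "card ({e \<in> induced E T. r \<in> e} \<union> X) \<le> 2"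
      using degr card_mono[OF _ sub_r] finE by simp
    moreover have finX: "finite X" using finE by (auto simp: X_def)
    ultimately have degT: "card {e \<in> induced E T. r \<in> e} + card X \<le> 2"
      using disj(3) finE by (subst card_Un_disjoint[symmetric]) auto
    obtain Q1 p1 par1 where 1: "removable_pairing E C c Q1 p1 par1"
      using less(1)[OF Tless(2) T(6) c(1) degC C(4)] by blast
    obtain Q2 p2 par2 where 2: "removable_pairing E T r Q2 p2 par2"
      using less(1)[OF Tless(1) T(5) T(1) _ conT] degT by auto
    \<comment> \<open>A second edge from \<open>r\<close> into \<open>C\<close> is the back edge
      ending in \<open>r\<close>, and then \<open>X\<close> as a whole is the pair of
      \<open>r\<close>. Which of the two is the tree edge does not matter for deletion.\<close>
    define Q where "Q = Q1 \<union> Q2 \<union> (if card X = 2 then {r} else {})"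
    define p where "p v = (if v \<in> C then p1 v else if v = r \<and> card X = 2 then X else p2 v)" for v
    define par where "par v = (if v = c then e0 else if v \<in> C then par1 v else par2 v)" for v
    have rp1: "Q1 \<subseteq> C" "\<And>v. v \<in> Q1 \<Longrightarrow> p1 v \<subseteq> {e \<in> induced E C. v \<in> e}" 
      "\<And>v. v \<in> Q1 \<Longrightarrow> card (p1 v) = 2" "\<And>v w. v \<in> Q1 \<Longrightarrow> w \<in> Q1 \<Longrightarrow> v \<noteq> w \<Longrightarrow> p1 v \<inter> p1 w = {}"
      "card (induced E C) + 1 = card C + card Q1" "inj_on par1 (C - {c})"
      "\<And>v. v \<in> C - {c} \<Longrightarrow> par1 v \<in> induced E C \<and> v \<in> par1 v \<and> (v \<in> Q1 \<longrightarrow> par1 v \<notin> p1 v)"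
      "\<And>D. (\<forall>v\<in>Q1. \<not> p1 v \<subseteq> D) \<Longrightarrow> D \<subseteq> \<Union> (p1 ` Q1) \<Longrightarrow> conn C (induced (E - D) C)"
      using 1 unfolding removable_pairing_def by blast+
    have rp2: "Q2 \<subseteq> T" "\<And>v. v \<in> Q2 \<Longrightarrow> p2 v \<subseteq> {e \<in> induced E T. v \<in> e}" 
      "\<And>v. v \<in> Q2 \<Longrightarrow> card (p2 v) = 2" "\<And>v w. v \<in> Q2 \<Longrightarrow> w \<in> Q2 \<Longrightarrow> v \<noteq> w \<Longrightarrow> p2 v \<inter> p2 w = {}"
      "card (induced E T) + 1 = card T + card Q2" "inj_on par2 (T - {r})"
      "\<And>v. v \<in> T - {r} \<Longrightarrow> par2 v \<in> induced E T \<and> v \<in> par2 v \<and> (v \<in> Q2 \<longrightarrow> par2 v \<notin> p2 v)"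
      "\<And>D. (\<forall>v\<in>Q2. \<not> p2 v \<subseteq> D) \<Longrightarrow> D \<subseteq> \<Union> (p2 ` Q2) \<Longrightarrow> conn T (induced (E - D) T)"
      using 2 unfolding removable_pairing_def by blast+
    have cX: "card X = 1 \<or> card X = 2" using degT Xne finX by (metis One_nat_def Suc_1 card_gt_0_iff
      le_SucE le_zero_eq add_leD2 not_gr_zero)
    \<comment> \<open>If both edges at \<open>r\<close> lead into \<open>C\<close>, none is left in
      \<open>T\<close> to form another pair at \<open>r\<close>.\<close>
    have rQ2: "r \<notin> Q2" if "card X = 2"
    proof
      assume "r \<in> Q2"
      then have "card (p2 r) \<le> card {e \<in> induced E T. r \<in> e}"
        using rp2(2) finE by (intro card_mono) auto
      then show False using rp2(3)[OF \<open>r \<in> Q2\<close>] degT that by simp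
    qed
    have pQ1: "p v = p1 v" if "v \<in> Q1" for v using that rp1(1) by (auto simp: p_def)
    have pQ2: "p v = p2 v" if "v \<in> Q2" for v using that rp2(1) T rQ2 by (auto simp: p_def)
    have pr: "p r = X" if "card X = 2" using that T by (auto simp: p_def)
    have finQ: "finite Q1" "finite Q2" using rp1(1) rp2(1) T finite_subset by blast+
    have Q12: "Q1 \<inter> Q2 = {}" "r \<notin> Q1" using rp1(1) rp2(1) T by auto
    have "removable_pairing E S r Q p par"
      unfolding removable_pairing_def
    proof (intro conjI ballI allI impI)
      show "Q \<subseteq> S" using rp1(1) rp2(1) T by (auto simp: Q_def)
    next
      fix v assume "v \<in> Q"
      then consider "v \<in> Q1" | "v \<in> Q2" | "v = r" "card X = 2" by (auto simp: Q_def split: if_splits)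
      then show "p v \<subseteq> {e \<in> induced E S. v \<in> e}"
      proof cases
        case 1 then show ?thesis using pQ1 rp1(2) T by fastforce
      next
        case 2 then show ?thesis using pQ2 rp2(2) T by fastforce
      next
        case 3 then show ?thesis using pr by (auto simp: X_def)
      qed
    next
      fix v assume "v \<in> Q"
      then show "card (p v) = 2"
        using pQ1 pQ2 pr rp1(3) rp2(3) by (auto simp: Q_def split: if_splits)
    next
      fix v w assume vw: "v \<in> Q" "w \<in> Q" "v \<noteq> w"
      have s1: "p v \<subseteq> induced E C" if "v \<in> Q1" for v using pQ1 rp1(2) that by fastforce
      have s2: "p v \<subseteq> induced E T" if "v \<in> Q2" for v using pQ2 rp2(2) that by fastforce
      have d: "A \<inter> B = {}" if "A \<subseteq> I1" "B \<subseteq> I2" "I1 \<inter> I2 = {} \<or> I2 \<inter> I1 = {}"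
        for A B I1 I2 :: "'a set set"
        using that by blast
      have cl: "u \<in> Q1 \<or> u \<in> Q2 \<or> (u = r \<and> p u \<subseteq> X)" if "u \<in> Q" for u
        using that pr by (cases "card X = 2") (auto simp: Q_def)
      from cl[OF vw(1)] cl[OF vw(2)] show "p v \<inter> p w = {}"
      proof (elim disjE conjE)
        assume "v \<in> Q1" "w \<in> Q1"
        then show ?thesis using rp1(4)[OF _ _ vw(3)] pQ1 by simp
      next
        assume "v \<in> Q2" "w \<in> Q2"
        then show ?thesis using rp2(4)[OF _ _ vw(3)] pQ2 by simp
      next
        assume "v \<in> Q1" "w \<in> Q2" then show ?thesis using d[OF s1 s2] disj(1) by metis
      next
        assume "v \<in> Q2" "w \<in> Q1" then show ?thesis using d[OF s2 s1] disj(1) by metis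
      next
        assume "v \<in> Q1" "p w \<subseteq> X" then show ?thesis using d[OF s1 _] disj(2) by metis
      next
        assume "v \<in> Q2" "p w \<subseteq> X" then show ?thesis using d[OF s2 _] disj(3) by metis
      next
        assume "p v \<subseteq> X" "w \<in> Q1" then show ?thesis using d[OF _ s1] disj(2) by metis
      next
        assume "p v \<subseteq> X" "w \<in> Q2" then show ?thesis using d[OF _ s2] disj(3) by metis
      next
        assume "v = r" "w = r" then show ?thesis using vw(3) by simp
      qed
    next
      have "card (induced E S) = card (induced E C) + card (induced E T) + card X"
      proof -
        have "(induced E C \<union> induced E T) \<inter> X = {}" using disj(2,3) by (simp add: Int_Un_distrib2)
        then have "card (induced E C \<union> induced E T \<union> X) = card (induced E C \<union> induced E T) + card X"
          by (intro card_Un_disjoint finite_UnI fin_ind finX)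
        also have "card (induced E C \<union> induced E T) = card (induced E C) + card (induced E T)"
          by (intro card_Un_disjoint fin_ind disj(1))
        finally show ?thesis by (simp only: Eeq)
      qed
      moreover have "card S = card C + card T"
        using card_Un_disjoint[of C T] T by simp
      \<comment> \<open>Both cases in one formula: \<open>card X - 1\<close> is the number of new
        pairs.\<close>
      moreover have "card Q + 1 = card Q1 + card Q2 + card X"
        using cX Q12 finQ rQ2 by (auto simp: Q_def card_Un_disjoint)
      ultimately show "card (induced E S) + 1 = card S + card Q"
        using rp1(5) rp2(5) by linarith
    next
      have k: "par v \<in> induced E C" if "v \<in> C - {c}" for v using that rp1(7) by (auto simp: par_def)
      have k2: "par v \<in> induced E T" if "v \<in> T - {r}" for v
        using rp2(7)[OF that] that T c by (auto simp: par_def)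
      have k3: "par c \<in> X" using e0 by (simp add: par_def)
      have i1: "inj_on par (C - {c})" using rp1(6) by (auto simp: inj_on_def par_def)
      have i2: "inj_on par (T - {r})" using rp2(6) T(3) c by (auto simp: inj_on_def par_def)
      have im: "par ` (C - {c}) \<subseteq> induced E C" "par ` (T - {r}) \<subseteq> induced E T"
        by (rule image_subsetI, erule k) (rule image_subsetI, erule k2)
      have "par c \<notin> induced E C \<union> induced E T"
        using IntI[OF _ k3] disj(2,3) by (metis UnE empty_iff)
      then have "par c \<notin> par ` (C - {c} \<union> (T - {r}))"
        using im unfolding image_Un by (meson Un_mono subsetD)
      moreover have d: "par ` (C - {c}) \<inter> par ` (T - {r}) = {}"
        by (rule subset_empty[THEN iffD1], rule order_trans[OF Int_mono[OF im]]) (simp only: disj(1) order_refl)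
      from d have "inj_on par (C - {c} \<union> (T - {r}))"
        unfolding inj_on_Un using i1 i2 by blast
      ultimately have "inj_on par (insert c (C - {c} \<union> (T - {r})))"
        unfolding inj_on_insert by blast
      moreover have "S - {r} = insert c (C - {c} \<union> (T - {r}))" using T c C(2) by auto
      ultimately show "inj_on par (S - {r})" by simp
    next
      fix v assume v: "v \<in> S - {r}"
      have sub: "induced E C \<subseteq> induced E S" "induced E T \<subseteq> induced E S" "X \<subseteq> induced E S"
        unfolding Eeq by auto
      have Q1: "v \<in> Q1" if "v \<in> C" "v \<in> Q"
        using that v rp2(1) T(3) by (auto simp: Q_def split: if_splits)
      have Q2: "v \<in> Q2" if "v \<in> T" "v \<in> Q"
        using that v rp1(1) T(3) by (auto simp: Q_def split: if_splits)
      consider "v = c" | "v \<in> C - {c}" | "v \<in> T - {r}" using T(4) v by auto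
      then have "par v \<in> induced E S \<and> v \<in> par v \<and> (v \<in> Q \<longrightarrow> par v \<notin> p v)"
      proof cases
        case 1
        then have "par v = e0" by (simp add: par_def)
        moreover have "e0 \<notin> p v" if "v \<in> Q"
        proof -
          have "v \<in> Q1" using Q1 that 1 c(1) by simp
          then have "p v \<subseteq> induced E C" using rp1(2)[of v] pQ1[of v] by auto
          then show ?thesis using e0 disj(2) by blast
        qed
        ultimately show ?thesis using 1 c(2) sub(3) e0 by blast
      next
        case 2
        then have pv: "par v = par1 v" by (simp add: par_def)
        have "p v = p1 v \<and> v \<in> Q1" if "v \<in> Q" using Q1 that 2 pQ1 by simp
        then show ?thesis unfolding pv using rp1(7)[OF 2] sub(1) by auto
      next
        case 3
        then have pv: "par v = par2 v" using T(3) c(1) by (auto simp: par_def)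
        have "p v = p2 v \<and> v \<in> Q2" if "v \<in> Q" using Q2 that 3 pQ2 by simp
        then show ?thesis unfolding pv using rp2(7)[OF 3] sub(2) by auto
      qed
      then show "par v \<in> induced E S" "v \<in> par v" "v \<in> Q \<Longrightarrow> par v \<notin> p v"
        by (blast, blast, blast)
    next
      fix D assume D: "\<forall>v\<in>Q. \<not> p v \<subseteq> D" "D \<subseteq> \<Union> (p ` Q)"
      have p1C: "p1 v \<subseteq> induced E C" if "v \<in> Q1" for v using rp1(2)[OF that] by auto
      have p2T: "p2 v \<subseteq> induced E T" if "v \<in> Q2" for v using rp2(2)[OF that] by auto
      have pQ: "\<Union> (p ` Q) \<subseteq> \<Union> (p1 ` Q1) \<union> \<Union> (p2 ` Q2) \<union> (if card X = 2 then X else {})"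
      proof (rule UN_least)
        fix v assume "v \<in> Q"
        then consider "v \<in> Q1" | "v \<in> Q2" | "v = r" "card X = 2"
          by (auto simp: Q_def split: if_splits)
        then show "p v \<subseteq> \<Union> (p1 ` Q1) \<union> \<Union> (p2 ` Q2) \<union> (if card X = 2 then X else {})"
          by cases (use pQ1[of v] pQ2[of v] pr in auto)
      qed
      have U1: "\<Union> (p1 ` Q1) \<subseteq> induced E C" by (rule UN_least, erule p1C)
      have U2: "\<Union> (p2 ` Q2) \<subseteq> induced E T" by (rule UN_least, erule p2T)
      have XX: "(if card X = 2 then X else {}) \<subseteq> X" by simp
      have k: "D \<inter> I \<subseteq> A" if "D \<subseteq> A \<union> B \<union> Y" "B \<subseteq> I2" "Y \<subseteq> I3" "I \<inter> I2 = {}" "I \<inter> I3 = {}"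
        for I I2 I3 A B Y :: "'a set set"
        using that by blast
      have DQ: "D \<subseteq> \<Union> (p1 ` Q1) \<union> \<Union> (p2 ` Q2) \<union> (if card X = 2 then X else {})"
        using D(2) pQ by (rule order_trans)
      have D1: "D \<inter> induced E C \<subseteq> \<Union> (p1 ` Q1)"
        by (rule k[OF DQ U2 XX disj(1,2)])
      have D2: "D \<inter> induced E T \<subseteq> \<Union> (p2 ` Q2)"
        using DQ disj(1) by (intro k[OF _ U1 XX _ disj(3)]) (simp_all only: Un_ac Int_commute)
      have ind: "induced (E - D \<inter> induced E A) A = induced (E - D) A" for A by auto
      have "\<forall>v\<in>Q1. \<not> p1 v \<subseteq> D \<inter> induced E C" using D(1) pQ1 by (auto simp: Q_def)
      from rp1(8)[OF this D1] have c1: "conn C (induced (E - D) C)" by (simp only: ind)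
      have "\<forall>v\<in>Q2. \<not> p2 v \<subseteq> D \<inter> induced E T" using D(1) pQ2 by (auto simp: Q_def)
      from rp2(8)[OF this D2] have c2: "conn T (induced (E - D) T)" by (simp only: ind)
      \<comment> \<open>An edge between the two parts survives: if \<open>X\<close> is a pair, it is
        not deleted entirely; otherwise its single edge \<open>e0\<close> lies in no pair.\<close>
      obtain f where f: "f \<in> X" "f \<notin> D"
      proof (cases "card X = 2")
        case True
        then show ?thesis using D(1) pr that by (auto simp: Q_def)
      next
        case False
        have "e0 \<notin> \<Union> (p1 ` Q1)" "e0 \<notin> \<Union> (p2 ` Q2)" 
          using subsetD[OF U1, of e0] subsetD[OF U2, of e0] IntI[OF _ e0] disj(2,3) by blast+
        then have "e0 \<notin> D" using subsetD[OF DQ, of e0] False by auto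
        then show ?thesis using that e0 by blast
      qed
      have "f \<in> E - D" "f \<subseteq> C \<union> T" "f \<inter> C \<noteq> {}" "f \<inter> T \<noteq> {}"
        using f T(1,4) by (auto simp: X_def)
      from conn_join[OF c1 c2 this] show "conn S (induced (E - D) S)" by (simp only: T(4))
    qed
    then show ?thesis by blast
  qed
qed

subsection \<open>Edmonds' perfect matching theorem\<close>

text \<open>Edmonds' description of the perfect matching polytope. Values are strictly positive
  because an edge whose value drops to 0 is deleted, which makes the instance smaller. The odd-set
  condition for \<open>U = V\<close> forces \<open>card V\<close> to be even.\<close>

definition fractional_pm :: "'v set \<Rightarrow> 'e set \<Rightarrow> ('e \<Rightarrow> 'v set) \<Rightarrow> ('e \<Rightarrow> real) \<Rightarrow> bool" where
  "fractional_pm V E ends x \<longleftrightarrow> finite V \<and> finite E \<and>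
     (\<forall>e\<in>E. ends e \<subseteq> V \<and> card (ends e) = 2 \<and> x e > 0) \<and>
     (\<forall>v\<in>V. sum x (ecut ends E {v}) = 1) \<and>
     (\<forall>U\<subseteq>V. odd (card U) \<longrightarrow> sum x (ecut ends E U) \<ge> 1)"

definition perfect_matching :: "'v set \<Rightarrow> 'e set \<Rightarrow> ('e \<Rightarrow> 'v set) \<Rightarrow> 'e set \<Rightarrow> bool" where
  "perfect_matching V E ends M \<longleftrightarrow> M \<subseteq> E \<and> (\<forall>v\<in>V. card (ecut ends M {v}) = 1)"

text \<open>By separation, this says that \<open>x\<close> lies in the convex hull of the perfect
  matchings. The form with weights avoids convex combinations and allows an argument to depend on
  \<open>w\<close>.\<close>

definition dominates_pm :: "'v set \<Rightarrow> 'e set \<Rightarrow> ('e \<Rightarrow> 'v set) \<Rightarrow> ('e \<Rightarrow> real) \<Rightarrow> bool" where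
  "dominates_pm V E ends x \<longleftrightarrow>
     (\<forall>w. \<exists>M. perfect_matching V E ends M \<and> sum w M \<le> (\<Sum>e\<in>E. w e * x e))"

text \<open>The same for the graph obtained by contracting \<open>U\<close>, but without performing the contraction.\<close>

definition dominates_pm_mod ::
  "'v set \<Rightarrow> 'e set \<Rightarrow> ('e \<Rightarrow> 'v set) \<Rightarrow> ('e \<Rightarrow> real) \<Rightarrow> 'v set \<Rightarrow> bool" where
  "dominates_pm_mod V E ends x U \<longleftrightarrow>
     (\<forall>w. \<exists>M. M \<subseteq> {e \<in> E. \<not> ends e \<subseteq> U} \<and> (\<forall>v\<in>V - U. card (ecut ends M {v}) = 1) \<and>
        card (ecut ends M U) = 1 \<and> sum w M \<le> (\<Sum>e \<in> {e \<in> E. \<not> ends e \<subseteq> U}. w e * x e))"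

section \<open>Contraction of a tight odd set and gluing\<close>

abbreviation contract :: "'v set \<Rightarrow> 'v \<Rightarrow> ('e \<Rightarrow> 'v set) \<Rightarrow> 'e \<Rightarrow> 'v set" where
  "contract U u ends e \<equiv> (\<lambda>v. if v \<in> U then u else v) ` ends e"

lemma ecut_alt: "ecut ends F U = {e \<in> F. (\<exists>v\<in>ends e. v \<in> U) \<and> (\<exists>v\<in>ends e. v \<notin> U)}"
  by (auto simp: ecut_def)

lemma ecut_contract:
  assumes "u \<in> U" "W \<inter> U \<subseteq> {u}"
  shows "ecut (contract U u ends) F W = ecut ends F (if u \<in> W then W \<union> U else W)"
proof -
  have "(if v \<in> U then u else v) \<in> W \<longleftrightarrow> v \<in> (if u \<in> W then W \<union> U else W)" for v
    using assms by auto
  then show ?thesis by (simp only: ecut_alt bex_simps)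
qed

lemma ecut_compl:
  assumes "\<forall>e\<in>F. ends e \<subseteq> V" "U \<subseteq> V"
  shows "ecut ends F (V - U) = ecut ends F U"
proof -
  have "(\<exists>v\<in>ends e. v \<in> V - U) \<longleftrightarrow> (\<exists>v\<in>ends e. v \<notin> U)"
    "(\<exists>v\<in>ends e. v \<notin> V - U) \<longleftrightarrow> (\<exists>v\<in>ends e. v \<in> U)" if "e \<in> F" for e
    using assms that by blast+
  then show ?thesis unfolding ecut_alt by auto
qed

lemma ecut_subset: "ecut ends F U \<subseteq> F"
  by (auto simp: ecut_def)

lemma finite_ecut: "finite F \<Longrightarrow> finite (ecut ends F U)"
  using ecut_subset finite_subset by metis

lemma ecut_singleton:
  "card (ends e) = 2 \<Longrightarrow> e \<in> ecut ends F {v} \<longleftrightarrow> e \<in> F \<and> v \<in> ends e"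
proof -
  assume "card (ends e) = 2"
  then have "\<not> ends e \<subseteq> {v}" using card_mono[of "{v}" "ends e"] by auto
  then show ?thesis by (auto simp: ecut_def)
qed

lemma fractional_pm_even:
  assumes "fractional_pm V E ends x"
  shows "even (card V)"
proof (rule ccontr)
  assume "odd (card V)"
  then have "sum x (ecut ends E V) \<ge> 1" using assms by (auto simp: fractional_pm_def)
  moreover have "ecut ends E V = {}" using assms by (auto simp: fractional_pm_def ecut_def)
  ultimately show False by simp
qed

text \<open>Tightness of \<open>U\<close> becomes the degree equation of \<open>u\<close>. An odd
  set \<open>W\<close> containing \<open>u\<close> stands for \<open>W \<union> U\<close>, which has
  \<open>card W - 1 + card U\<close> vertices and is therefore odd again.\<close>

lemma fractional_pm_contract:
  assumes f: "fractional_pm V E ends x" and U: "U \<subseteq> V" "odd (card U)" "u \<in> U"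
    and tight: "sum x (ecut ends E U) = 1"
  shows "fractional_pm (insert u (V - U)) {e \<in> E. \<not> ends e \<subseteq> U} (contract U u ends) x"
proof -
  let ?E = "{e \<in> E. \<not> ends e \<subseteq> U}" and ?V = "insert u (V - U)" and ?c = "contract U u ends"
  note F = f[unfolded fractional_pm_def]
  have finU: "finite U" using F U(1) finite_subset by blast
  have cut: "ecut ?c ?E W = ecut ends E (if u \<in> W then W \<union> U else W)" if "W \<subseteq> ?V" for W
  proof -
    have "ecut ?c ?E W = ecut ends ?E (if u \<in> W then W \<union> U else W)"
      using that U by (intro ecut_contract) auto
    also have "\<dots> = ecut ends E (if u \<in> W then W \<union> U else W)"
      using that U by (auto simp: ecut_def)
    finally show ?thesis .
  qed
  have "?c e \<subseteq> ?V \<and> card (?c e) = 2 \<and> x e > 0" if e: "e \<in> ?E" for e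
  proof -
    obtain a b where ab: "ends e = {a, b}" "a \<noteq> b"
      using F e by (metis (lifting) card_2_iff mem_Collect_eq)
    then have "a \<in> V" "b \<in> V" "\<not> (a \<in> U \<and> b \<in> U)" "x e > 0" using F e by auto
    then have "a \<in> U \<Longrightarrow> b \<noteq> u" "b \<in> U \<Longrightarrow> a \<noteq> u" using U(3) by blast+
    moreover have "?c e = {if a \<in> U then u else a, if b \<in> U then u else b}" using ab by simp
    ultimately show ?thesis using ab(2) U(3) \<open>a \<in> V\<close> \<open>b \<in> V\<close> \<open>\<not> (a \<in> U \<and> b \<in> U)\<close> \<open>x e > 0\<close>
      by (cases "a \<in> U"; cases "b \<in> U") simp_all
  qed
  moreover have "sum x (ecut ?c ?E {v}) = 1" if "v \<in> ?V" for v
  proof (cases "v = u")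
    case True
    then show ?thesis using cut[of "{v}"] tight U by (simp add: insert_absorb)
  next
    case False
    then show ?thesis using cut[of "{v}"] that F by simp
  qed
  moreover have "sum x (ecut ?c ?E W) \<ge> 1" if W: "W \<subseteq> ?V" "odd (card W)" for W
  proof (cases "u \<in> W")
    case True
    have finW: "finite W" using W(1) F by (meson finite_Diff finite_insert finite_subset)
    have "W \<union> U = (W - {u}) \<union> U" "(W - {u}) \<inter> U = {}" using W U by auto
    then have "card (W \<union> U) = card (W - {u}) + card U"
      using card_Un_disjoint[of "W - {u}" U] finW finU by simp
    moreover have "card W = Suc (card (W - {u}))"
      using True finW by (metis card.remove)
    ultimately have "odd (card (W \<union> U))" using W U by auto
    moreover have "W \<union> U \<subseteq> V" using W U by auto
    ultimately show ?thesis using F cut[OF W(1)] True by simp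
  next
    case False
    then have "W \<subseteq> V" using W by auto
    then show ?thesis using F cut[OF W(1)] False W by simp
  qed
  ultimately show ?thesis using F unfolding fractional_pm_def by simp
qed

lemma dominates_pm_contract:
  assumes "dominates_pm (insert u (V - U)) {e \<in> E. \<not> ends e \<subseteq> U} (contract U u ends) x" "u \<in> U"
  shows "dominates_pm_mod V E ends x U"
  unfolding dominates_pm_mod_def
proof
  fix w
  obtain M where M: "M \<subseteq> {e \<in> E. \<not> ends e \<subseteq> U}"
    "\<And>v. v \<in> insert u (V - U) \<Longrightarrow> card (ecut (contract U u ends) M {v}) = 1"
    "sum w M \<le> (\<Sum>e \<in> {e \<in> E. \<not> ends e \<subseteq> U}. w e * x e)"
    using assms(1)[unfolded dominates_pm_def perfect_matching_def, rule_format, of w] by blast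
  have cut: "ecut (contract U u ends) M {v} = ecut ends M (if u = v then U else {v})"
    if "v \<in> insert u (V - U)" for v
  proof -
    have "ecut (contract U u ends) M {v} = ecut ends M (if u \<in> {v} then {v} \<union> U else {v})"
      using M(1) assms(2) that by (intro ecut_contract) auto
    moreover have "(if u \<in> {v} then {v} \<union> U else {v}) = (if u = v then U else {v})"
      using assms(2) by auto
    ultimately show ?thesis by (simp only:)
  qed
  have "card (ecut ends M {v}) = 1" if "v \<in> V - U" for v
    using M(2)[of v] cut[of v] that assms(2) by (auto split: if_splits)
  moreover have "card (ecut ends M U) = 1" using M(2)[of u] cut[of u] by simp
  ultimately show "\<exists>M. M \<subseteq> {e \<in> E. \<not> ends e \<subseteq> U} \<and> (\<forall>v\<in>V - U. card (ecut ends M {v}) = 1) \<and>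
        card (ecut ends M U) = 1 \<and> sum w M \<le> (\<Sum>e \<in> {e \<in> E. \<not> ends e \<subseteq> U}. w e * x e)"
    using M by blast
qed

text \<open>A matching of the one side is charged, through the weight of its cut edge \<open>f\<close>, with the
  cheapest way \<open>N f\<close> to extend it to the other side.\<close>

lemma dominates_pm_glue:
  assumes f: "fractional_pm V E ends x" and U: "U \<subseteq> V"
    and d1: "dominates_pm_mod V E ends x U" and d2: "dominates_pm_mod V E ends x (V - U)"
  shows "dominates_pm V E ends x"
  unfolding dominates_pm_def
proof
  fix w :: "'b \<Rightarrow> real"
  note F = f[unfolded fractional_pm_def]
  define K where "K = ecut ends E U"
  define E1 where "E1 = {e \<in> E. \<not> ends e \<subseteq> U}"
  define E2 where "E2 = {e \<in> E. \<not> ends e \<subseteq> V - U}"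
  define I where "I = {e \<in> E. ends e \<subseteq> U}"
  have eV: "ends e \<subseteq> V" "card (ends e) = 2" if "e \<in> E" for e using F that by auto
  have ene: "ends e \<noteq> {}" if "e \<in> E" for e using eV(2)[OF that] by auto
  have E2: "E2 = I \<union> K" "I \<inter> K = {}"
    using eV ene by (fastforce simp: E2_def I_def K_def ecut_def)+
  have E1: "E = E1 \<union> I" "E1 \<inter> I = {}" by (auto simp: E1_def I_def)
  have K: "K \<subseteq> E1" "E1 \<inter> E2 = K"
    using eV by (fastforce simp: E1_def E2_def K_def ecut_def)+
  have fin: "finite E" "finite E1" "finite E2" "finite I" "finite K"
    using F by (auto simp: E1_def E2_def I_def K_def ecut_def)
  have cutK: "ecut ends M U = M \<inter> K" if "M \<subseteq> E" for M
    using that by (auto simp: K_def ecut_def)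
  define good where "good f M \<longleftrightarrow> M \<subseteq> E2 \<and> (\<forall>v\<in>U. card (ecut ends M {v}) = 1) \<and> M \<inter> K = {f}" for f M
  have dom2: "\<exists>g M. good g M \<and> sum w' M \<le> (\<Sum>e\<in>E2. w' e * x e)" for w'
  proof -
    have VU: "V - (V - U) = U" using U by auto
    obtain M where M: "M \<subseteq> E2" "\<forall>v\<in>U. card (ecut ends M {v}) = 1"
        "card (ecut ends M (V - U)) = 1" "sum w' M \<le> (\<Sum>e\<in>E2. w' e * x e)"
      using d2[unfolded dominates_pm_mod_def E2_def[symmetric] VU, rule_format, of w'] by blast
    have "ecut ends M (V - U) = M \<inter> K"
      using ecut_compl[of M ends V U] M(1) eV U cutK[of M] by (auto simp: E2_def)
    then obtain g where "M \<inter> K = {g}" using M(3) by (auto simp: card_1_singleton_iff)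
    then show ?thesis using M by (auto simp: good_def)
  qed
  \<comment> \<open>Weight -1 on \<open>f\<close> alone gives total weight \<open>- x f < 0\<close>,
    so the matching that the hypothesis supplies has to contain \<open>f\<close>.\<close>
  have "\<exists>M. good f M" if "f \<in> K" for f
  proof -
    obtain g M where M: "good g M"
      "(\<Sum>e\<in>M. if e = f then - 1 else 0) \<le> (\<Sum>e\<in>E2. (if e = f then - 1 else 0) * x e)"
      using dom2[of "\<lambda>e. if e = f then - 1 else 0"] by auto
    have "f \<in> E2" "x f > 0" using that E2 F by (auto simp: K_def ecut_def)
    have "finite M" using M(1) fin finite_subset by (auto simp: good_def)
    have "(\<Sum>e\<in>E2. (if e = f then - 1 else 0) * x e) = (\<Sum>e\<in>E2. if e = f then - x e else 0)"
      by (intro sum.cong) auto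
    also have "\<dots> = - x f" using \<open>f \<in> E2\<close> fin by simp
    finally have "f \<in> M" using M(2) \<open>x f > 0\<close> \<open>finite M\<close> by (auto split: if_splits)
    then have "g = f" using M(1) that by (auto simp: good_def)
    then show ?thesis using M by auto
  qed
  moreover have "finite {M. good f M}" for f
    using fin by (auto simp: good_def intro: finite_subset[of _ "Pow E2"])
  ultimately have "\<forall>f\<in>K. \<exists>M. good f M \<and> (\<forall>M'. good f M' \<longrightarrow> sum w (M - {f}) \<le> sum w (M' - {f}))"
    using ex_is_arg_min_if_finite[of "{M. good f M}" "\<lambda>M. sum w (M - {f})" for f]
    by (fastforce simp: is_arg_min_linorder)
  then obtain N where N: "\<And>f. f \<in> K \<Longrightarrow> good f (N f)"
      "\<And>f M. f \<in> K \<Longrightarrow> good f M \<Longrightarrow> sum w (N f - {f}) \<le> sum w (M - {f})"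
    by metis
  define m where "m f = sum w (N f - {f})" for f
  \<comment> \<open>With weight \<open>- m e\<close> on the cut edges, every matching of this side
    has nonnegative weight by the minimality of \<open>N\<close>; domination carries this over to
    \<open>x\<close>.\<close>
  have inner: "(\<Sum>e\<in>K. m e * x e) \<le> (\<Sum>e\<in>I. w e * x e)"
  proof -
    let ?w = "\<lambda>e. if e \<in> K then - m e else w e"
    obtain g M where M: "good g M" "sum ?w M \<le> (\<Sum>e\<in>E2. ?w e * x e)" using dom2 by blast
    then have g: "g \<in> K" "g \<in> M" "finite M" using fin finite_subset by (auto simp: good_def)
    have "sum ?w M = - m g + sum ?w (M - {g})" using g by (simp add: sum.remove)
    also have "sum ?w (M - {g}) = sum w (M - {g})"
      using M(1) by (intro sum.cong) (auto simp: good_def)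
    finally have "sum ?w M \<ge> 0" using N(2)[OF g(1) M(1)] by (simp add: m_def)
    moreover have "(\<Sum>e\<in>E2. ?w e * x e) = (\<Sum>e\<in>I. ?w e * x e) + (\<Sum>e\<in>K. ?w e * x e)"
      unfolding E2(1) using fin E2(2) by (intro sum.union_disjoint) auto
    moreover have "(\<Sum>e\<in>I. ?w e * x e) = (\<Sum>e\<in>I. w e * x e)"
      using E2(2) by (intro sum.cong) auto
    moreover have "(\<Sum>e\<in>K. ?w e * x e) = - (\<Sum>e\<in>K. m e * x e)"
      by (simp add: sum_negf)
    ultimately show ?thesis using M(2) by linarith
  qed
  let ?w = "\<lambda>e. w e + (if e \<in> K then m e else 0)"
  obtain M1 where M1: "M1 \<subseteq> E1" "\<forall>v\<in>V - U. card (ecut ends M1 {v}) = 1"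
        "card (ecut ends M1 U) = 1" "sum ?w M1 \<le> (\<Sum>e\<in>E1. ?w e * x e)"
    using d1[unfolded dominates_pm_mod_def E1_def[symmetric], rule_format, of ?w] by blast
  have M1E: "M1 \<subseteq> E" "finite M1"
    using M1(1) finite_subset[OF M1(1) fin(2)] by (auto simp: E1_def)
  then obtain g where g: "M1 \<inter> K = {g}" using M1(3) cutK by (auto simp: card_1_singleton_iff)
  then have gK: "g \<in> K" by auto
  have Ng: "N g \<subseteq> E2" "\<forall>v\<in>U. card (ecut ends (N g) {v}) = 1" "N g \<inter> K = {g}"
    using N(1)[OF gK] by (auto simp: good_def)
  have Nfin: "finite (N g)" using finite_subset[OF Ng(1) fin(3)] .
  let ?M = "M1 \<union> N g"
  have ME: "?M \<subseteq> E" using M1E Ng(1) by (auto simp: E2_def)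
  have "card (ecut ends ?M {v}) = 1" if "v \<in> V" for v
  proof (cases "v \<in> U")
    case True
    have "ecut ends ?M {v} = ecut ends (N g) {v}"
    proof -
      have "e \<in> K" if "e \<in> ecut ends M1 {v}" for e
        using that True M1(1) by (auto simp: K_def E1_def ecut_def)
      moreover have "g \<in> N g" using Ng(3) by auto
      ultimately have "ecut ends M1 {v} \<subseteq> ecut ends (N g) {v}"
        using g by (fastforce simp: ecut_def)
      then show ?thesis by (auto simp: ecut_def)
    qed
    then show ?thesis using Ng True by simp
  next
    case False
    have "ecut ends ?M {v} = ecut ends M1 {v}"
    proof -
      have "e \<in> K" if "e \<in> ecut ends (N g) {v}" for e
      proof -
        have "v \<in> ends e" "e \<in> E2" using that Ng(1) by (auto simp: ecut_def)
        then have "e \<notin> I" using False by (auto simp: I_def)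
        then show ?thesis using E2 \<open>e \<in> E2\<close> by auto
      qed
      moreover have "g \<in> M1" using g by auto
      ultimately have "ecut ends (N g) {v} \<subseteq> ecut ends M1 {v}"
        using Ng(3) by (fastforce simp: ecut_def)
      then show ?thesis by (auto simp: ecut_def)
    qed
    then show ?thesis using M1 False that by simp
  qed
  then have "perfect_matching V E ends ?M" using ME by (simp add: perfect_matching_def)
  moreover have "sum w ?M \<le> (\<Sum>e\<in>E. w e * x e)"
  proof -
    have "M1 \<inter> N g \<subseteq> K" using M1(1) Ng(1) K by blast
    then have "M1 \<inter> (N g - {g}) = {}" using g by blast
    moreover have "?M = M1 \<union> (N g - {g})" using g by auto
    ultimately have "sum w ?M = sum w M1 + m g"
      using M1E(2) Nfin by (simp add: m_def sum.union_disjoint)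
    also have "\<dots> = sum ?w M1"
    proof -
      have "(\<Sum>e\<in>M1. if e \<in> K then m e else 0) = sum m (M1 \<inter> K)"
        using M1E(2) by (simp add: sum.inter_restrict)
      then show ?thesis using g by (simp add: sum.distrib)
    qed
    also have "\<dots> \<le> (\<Sum>e\<in>E1. ?w e * x e)" by (rule M1(4))
    also have "\<dots> = (\<Sum>e\<in>E1. w e * x e) + (\<Sum>e\<in>E1. if e \<in> K then m e * x e else 0)"
      by (subst sum.distrib[symmetric], intro sum.cong) (auto simp: algebra_simps)
    also have "(\<Sum>e\<in>E1. if e \<in> K then m e * x e else 0) = (\<Sum>e\<in>K. m e * x e)"
      using fin K(1) by (simp add: sum.inter_restrict[symmetric] Int_absorb1)
    also have "(\<Sum>e\<in>E1. w e * x e) + (\<Sum>e\<in>K. m e * x e)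
        \<le> (\<Sum>e\<in>E1. w e * x e) + (\<Sum>e\<in>I. w e * x e)" using inner by simp
    also have "\<dots> = (\<Sum>e\<in>E. w e * x e)"
      by (subst E1(1), rule sum.union_disjoint[symmetric]) (use fin E1 in auto)
    finally show ?thesis .
  qed
  ultimately show "\<exists>M. perfect_matching V E ends M \<and> sum w M \<le> (\<Sum>e\<in>E. w e * x e)" by blast
qed

text \<open>Since \<open>card V\<close> is even, the complement of \<open>U\<close> is odd as well,
  and it has the same cut. Both sides have more than one vertex, so contracting either of them gives
  an instance with fewer vertices.\<close>

lemma dominates_pm_tight:
  fixes V :: "'v set" and E :: "'e set"
  assumes f: "fractional_pm V E ends x" and U: "U \<subseteq> V" "odd (card U)" "1 < card U" "card U + 1 < card V"
    and tight: "sum x (ecut ends E U) = 1"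
    and IH: "\<And>(V' :: 'v set) (E' :: 'e set) ends' x'. card V' < card V \<Longrightarrow> E' \<subseteq> E \<Longrightarrow>
        fractional_pm V' E' ends' x' \<Longrightarrow> dominates_pm V' E' ends' x'"
  shows "dominates_pm V E ends x"
proof -
  have fin: "finite V" "finite U" using f U(1) finite_subset by (auto simp: fractional_pm_def)
  have *: "dominates_pm_mod V E ends x W"
    if W: "W \<subseteq> V" "odd (card W)" "1 < card W" "sum x (ecut ends E W) = 1" for W
  proof -
    obtain u where u: "u \<in> W" using W(3) by fastforce
    have "card (insert u (V - W)) = Suc (card V - card W)"
      using u W fin by (simp add: card_Diff_subset finite_subset)
    then have "card (insert u (V - W)) < card V"
      using W(3) card_mono[OF fin(1) W(1)] by linarith
    then have "dominates_pm (insert u (V - W)) {e \<in> E. \<not> ends e \<subseteq> W} (contract W u ends) x"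
      using fractional_pm_contract[OF f W(1,2) u W(4)] by (intro IH) auto
    then show ?thesis by (rule dominates_pm_contract[OF _ u])
  qed
  have c: "card (V - U) = card V - card U" using U fin by (simp add: card_Diff_subset)
  have VU: "odd (card (V - U))" "1 < card (V - U)"
    unfolding c using U(2,4) fractional_pm_even[OF f] by presburger+
  have "ecut ends E (V - U) = ecut ends E U"
    using f U(1) by (intro ecut_compl) (auto simp: fractional_pm_def)
  then have "sum x (ecut ends E (V - U)) = 1" using tight by (simp only:)
  then show ?thesis
    by (intro dominates_pm_glue[OF f U(1)] *[OF U(1-3) tight] *[OF Diff_subset VU])
qed

section \<open>Moving along a kernel vector\<close>

text \<open>Gaussian elimination: equation \<open>i\<close> is solved for a variable
  \<open>k\<close> with nonzero coefficient and substituted into the others, which removes one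
  equation and one variable.\<close>

lemma homogeneous_solution:
  fixes a :: "'i \<Rightarrow> 'j \<Rightarrow> real"
  assumes "finite I" "finite J" "card I < card J"
  shows "\<exists>y. (\<exists>j\<in>J. y j \<noteq> 0) \<and> (\<forall>i\<in>I. (\<Sum>j\<in>J. a i j * y j) = 0)"
  using assms
proof (induction I arbitrary: J a rule: finite_induct)
  case empty
  then have "J \<noteq> {}" by auto
  then show ?case by (intro exI[of _ "\<lambda>_. 1"]) auto
next
  case (insert i I)
  show ?case
  proof (cases "\<forall>j\<in>J. a i j = 0")
    case True
    have "card I < card J" using insert.prems(2) insert.hyps by simp
    then obtain y where "\<exists>j\<in>J. y j \<noteq> 0" "\<forall>i\<in>I. (\<Sum>j\<in>J. a i j * y j) = 0"
      using insert.IH[OF insert.prems(1), of a] by blast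
    then show ?thesis using True by (intro exI[of _ y]) auto
  next
    case False
    then obtain k where k: "k \<in> J" "a i k \<noteq> 0" by auto
    let ?J = "J - {k}"
    have "card I < card ?J" using insert k by simp
    then obtain y where y: "\<exists>j\<in>?J. y j \<noteq> 0"
        "\<forall>i'\<in>I. (\<Sum>j\<in>?J. (a i' j - a i' k * a i j / a i k) * y j) = 0"
      using insert.IH[of ?J "\<lambda>i' j. a i' j - a i' k * a i j / a i k"] insert.prems(1) by blast
    define s where "s = - (\<Sum>j\<in>?J. a i j * y j) / a i k"
    define z where "z = y(k := s)"
    have split: "(\<Sum>j\<in>J. a i' j * z j) = a i' k * s + (\<Sum>j\<in>?J. a i' j * y j)" for i'
    proof -
      have "(\<Sum>j\<in>J. a i' j * z j) = a i' k * z k + (\<Sum>j\<in>?J. a i' j * z j)"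
        using k insert.prems by (simp add: sum.remove)
      also have "(\<Sum>j\<in>?J. a i' j * z j) = (\<Sum>j\<in>?J. a i' j * y j)"
        by (intro sum.cong) (auto simp: z_def)
      finally show ?thesis by (simp add: z_def)
    qed
    have "(\<Sum>j\<in>J. a i' j * z j) = 0" if "i' \<in> I" for i'
    proof -
      have "0 = (\<Sum>j\<in>?J. a i' j * y j) - (\<Sum>j\<in>?J. a i' k / a i k * (a i j * y j))"
        using y(2) that by (simp add: sum_subtractf left_diff_distrib mult.assoc)
      also have "(\<Sum>j\<in>?J. a i' k / a i k * (a i j * y j)) = a i' k / a i k * (\<Sum>j\<in>?J. a i j * y j)"
        by (simp add: sum_distrib_left)
      finally show ?thesis unfolding split s_def by simp
    qed
    moreover have "(\<Sum>j\<in>J. a i j * z j) = 0" unfolding split s_def using k by simp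
    moreover have "\<exists>j\<in>J. z j \<noteq> 0" using y(1) by (auto simp: z_def)
    ultimately show ?thesis by (intro exI[of _ z]) auto
  qed
qed

text \<open>The ratio test of the simplex method: \<open>s\<close> holds the slacks,
  \<open>d\<close> their rates of change, and the step length \<open>t\<close> is the least ratio
  over the decreasing constraints.\<close>

lemma first_tight_constraint:
  fixes s d :: "'j \<Rightarrow> real"
  assumes "finite J" "\<And>j. j \<in> J \<Longrightarrow> s j \<ge> 0" "j0 \<in> J" "d j0 < 0"
  obtains t j where "t \<ge> 0" "\<And>j. j \<in> J \<Longrightarrow> s j + t * d j \<ge> 0" "j \<in> J" "d j < 0" "s j + t * d j = 0"
proof -
  define N where "N = {j \<in> J. d j < 0}"
  have N: "finite N" "N \<noteq> {}" using assms by (auto simp: N_def)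
  define t where "t = Min ((\<lambda>j. s j / (- d j)) ` N)"
  have "t \<in> (\<lambda>j. s j / (- d j)) ` N" unfolding t_def using N by (intro Min_in) auto
  then obtain j where j: "j \<in> N" "t = s j / (- d j)" by auto
  have le: "t \<le> s i / (- d i)" if "i \<in> N" for i
    unfolding t_def using N that by (intro Min_le) auto
  have t0: "t \<ge> 0" using j assms(2)[of j] by (simp add: N_def divide_nonneg_neg)
  have "s i + t * d i \<ge> 0" if "i \<in> J" for i
  proof (cases "d i < 0")
    case True
    then have "t \<le> s i / (- d i)" using le that by (simp add: N_def)
    then have "t * (- d i) \<le> s i" using True by (simp only: pos_le_divide_eq neg_0_less_iff_less)
    then show ?thesis by simp
  next
    case False
    then show ?thesis using t0 assms(2)[OF that] by simp
  qed
  moreover have "s j + t * d j = 0" "d j < 0" "j \<in> J" using j by (auto simp: N_def)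
  ultimately show ?thesis using that[of t j] t0 by blast
qed

text \<open>Moving along \<open>y\<close> preserves all degree equations. For a given
  \<open>w\<close>, one of \<open>y\<close> and \<open>- y\<close> does not raise the weight; the
  point moves in that direction until a constraint becomes tight. Then either some edge vanishes, or
  an odd set is tight and the graph is split there.\<close>

lemma dominates_pm_kernel:
  fixes V :: "'v set" and E :: "'e set" and y :: "'e \<Rightarrow> real"
  assumes f: "fractional_pm V E ends x"
    and y: "\<And>v. v \<in> V \<Longrightarrow> sum y (ecut ends E {v}) = 0" "e0 \<in> E" "y e0 \<noteq> 0"
    and IH: "\<And>(V' :: 'v set) (E' :: 'e set) ends' x'. card V' + card E' < card V + card E \<Longrightarrow>
        fractional_pm V' E' ends' x' \<Longrightarrow> dominates_pm V' E' ends' x'"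
  shows "dominates_pm V E ends x"
  unfolding dominates_pm_def
proof
  fix w :: "'e \<Rightarrow> real"
  note F = f[unfolded fractional_pm_def]
  have main: "\<exists>M. perfect_matching V E ends M \<and> sum w M \<le> (\<Sum>e\<in>E. w e * x e)"
    if z: "\<And>v. v \<in> V \<Longrightarrow> sum z (ecut ends E {v}) = 0" "z e0 \<noteq> 0" "(\<Sum>e\<in>E. w e * z e) \<le> 0"
    for z
  proof -
    \<comment> \<open>The movement has to stop: the values of \<open>z\<close> at an end of
      \<open>e0\<close> sum to 0 and one of them is nonzero, so they cannot all be
      nonnegative.\<close>
    have "\<exists>e\<in>E. z e < 0"
    proof (rule ccontr)
      assume "\<not> (\<exists>e\<in>E. z e < 0)"
      then have pos: "\<And>e. e \<in> E \<Longrightarrow> z e \<ge> 0" by force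
      have e0: "card (ends e0) = 2" "ends e0 \<subseteq> V" using F y(2) by auto
      from e0(1) have "ends e0 \<noteq> {}" by auto
      then obtain v where v: "v \<in> ends e0" "v \<in> V" using e0(2) by blast
      then have "e0 \<in> ecut ends E {v}" using y(2) e0 by (simp add: ecut_singleton)
      moreover have "finite (ecut ends E {v})" using F finite_ecut by blast
      ultimately have "z e0 \<le> sum z (ecut ends E {v})"
        using pos ecut_subset by (intro member_le_sum) (auto simp: ecut_def)
      then show False using z(1)[OF v(2)] z(2) pos[OF y(2)] by simp
    qed
    then obtain e1 where e1: "e1 \<in> E" "z e1 < 0" by blast
    \<comment> \<open>\<open>Inl e\<close> stands for the constraint that the value of
      \<open>e\<close> is nonnegative, \<open>Inr U\<close> for the odd-set constraint of
      \<open>U\<close>.\<close>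
    define J where "J = Inl ` E \<union> Inr ` {U. U \<subseteq> V \<and> odd (card U)}"
    define s where "s = case_sum x (\<lambda>U. sum x (ecut ends E U) - 1)"
    define d where "d = case_sum z (\<lambda>U. sum z (ecut ends E U))"
    have "finite J" using F by (auto simp: J_def)
    moreover have "s j \<ge> 0" if "j \<in> J" for j
      using F that by (auto simp: J_def s_def less_imp_le)
    moreover have "Inl e1 \<in> J" "d (Inl e1) < 0" using e1 by (auto simp: J_def d_def)
    ultimately obtain t j where t: "t \<ge> 0" "\<And>j. j \<in> J \<Longrightarrow> s j + t * d j \<ge> 0"
      and j: "j \<in> J" "d j < 0" "s j + t * d j = 0"
      using first_tight_constraint[of J s "Inl e1" d] by blast
    define x' where "x' e = x e + t * z e" for e
    have sumx': "sum x' A = sum x A + t * sum z A" for A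
      by (simp add: x'_def sum.distrib sum_distrib_left)
    have x'0: "x' e \<ge> 0" if "e \<in> E" for e
      using t(2)[of "Inl e"] that by (simp add: J_def s_def d_def x'_def)
    have x'cut: "sum x' (ecut ends E U) \<ge> 1" if "U \<subseteq> V" "odd (card U)" for U
      using t(2)[of "Inr U"] that by (simp add: J_def s_def d_def sumx')
    define E' where "E' = {e \<in> E. x' e > 0}"
    have E': "E' \<subseteq> E" "finite E" "finite E'" using F by (auto simp: E'_def)
    have sumE': "sum x' (ecut ends E' U) = sum x' (ecut ends E U)" for U
    proof (rule sum.mono_neutral_left)
      show "finite (ecut ends E U)" using F finite_ecut by blast
      show "ecut ends E' U \<subseteq> ecut ends E U" using E' by (auto simp: ecut_def)
      show "\<forall>e\<in>ecut ends E U - ecut ends E' U. x' e = 0"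
        using x'0 by (auto simp: ecut_def E'_def less_le)
    qed
    have f': "fractional_pm V E' ends x'"
      unfolding fractional_pm_def sumE'
      using F x'cut E' z(1) by (auto simp: sumx' E'_def)
    have "dominates_pm V E' ends x'"
    proof (cases "E' = E")
      case False
      then have "card E' < card E" using E' by (intro psubset_card_mono) auto
      then show ?thesis using f' by (intro IH) auto
    next
      case True
      \<comment> \<open>No edge vanished, so the tight constraint belongs to an odd set. Its cut sum
        decreases along \<open>z\<close>, whereas the cut of a single vertex, or of its complement,
        has \<open>z\<close>-sum 0; hence both sides of \<open>U\<close> are large enough to
        contract.\<close>
      obtain U where U: "j = Inr U" "U \<subseteq> V" "odd (card U)"
      proof (cases j)
        case (Inl e)
        then have "e \<in> E" "x' e = 0" using j by (auto simp: J_def s_def d_def x'_def)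
        moreover then have "e \<in> E'" using True by simp
        ultimately show ?thesis by (simp add: E'_def)
      next
        case (Inr U)
        then show ?thesis using j that by (auto simp: J_def)
      qed
      have zU: "sum z (ecut ends E U) < 0" using j U by (simp add: d_def)
      have finV: "finite V" and finU: "finite U" using F U(2) finite_subset by auto
      have "card U \<noteq> 1"
      proof
        assume "card U = 1"
        then obtain v where "U = {v}" by (auto simp: card_1_singleton_iff)
        then show False using zU z(1)[of v] U(2) by auto
      qed
      moreover have "card U \<noteq> 0" using U(3) by (metis even_zero)
      moreover have "card (V - U) \<noteq> 1"
      proof
        assume "card (V - U) = 1"
        then obtain v where v: "V - U = {v}" by (auto simp: card_1_singleton_iff)
        have "ecut ends E (V - U) = ecut ends E U" using F U by (intro ecut_compl) auto
        moreover have "v \<in> V" using v by auto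
        ultimately show False using zU z(1)[of v] v by simp
      qed
      moreover have "card (V - U) = card V - card U" "card U \<le> card V"
        using U(2) finV finU by (auto simp: card_Diff_subset card_mono)
      moreover have "card V \<noteq> card U" using U(3) fractional_pm_even[OF f] by metis
      ultimately have cU: "1 < card U" "card U + 1 < card V" by linarith+
      have tight: "sum x' (ecut ends E' U) = 1"
      proof -
        have "sum x' (ecut ends E U) = 1" using j(3) by (simp add: U(1) sumx' s_def d_def)
        then show ?thesis by (simp only: sumE')
      qed
      show ?thesis
      proof (rule dominates_pm_tight[OF f' U(2,3) cU tight])
        fix V2 :: "'v set" and E2 :: "'e set" and ends2 x2
        assume a: "card V2 < card V" "E2 \<subseteq> E'" "fractional_pm V2 E2 ends2 x2"
        have "card E2 \<le> card E" using a(2) E' by (meson card_mono order_trans)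
        then show "dominates_pm V2 E2 ends2 x2" using a by (intro IH) auto
      qed
    qed
    then obtain M where M: "perfect_matching V E' ends M" "sum w M \<le> (\<Sum>e\<in>E'. w e * x' e)"
      unfolding dominates_pm_def by blast
    have "(\<Sum>e\<in>E'. w e * x' e) = (\<Sum>e\<in>E. w e * x' e)"
      using E' x'0 by (intro sum.mono_neutral_left) (auto simp: E'_def less_le)
    also have "\<dots> = (\<Sum>e\<in>E. w e * x e) + t * (\<Sum>e\<in>E. w e * z e)"
      by (simp add: x'_def sum.distrib sum_distrib_left algebra_simps)
    also have "\<dots> \<le> (\<Sum>e\<in>E. w e * x e)"
      using t(1) z(3) by (simp add: mult_nonneg_nonpos)
    finally have "sum w M \<le> (\<Sum>e\<in>E. w e * x e)" using M(2) by linarith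
    moreover have "perfect_matching V E ends M" using M(1) E' by (auto simp: perfect_matching_def)
    ultimately show ?thesis by blast
  qed
  show "\<exists>M. perfect_matching V E ends M \<and> sum w M \<le> (\<Sum>e\<in>E. w e * x e)"
  proof (cases "(\<Sum>e\<in>E. w e * y e) \<le> 0")
    case True
    then show ?thesis using main[of y] y by blast
  next
    case False
    then show ?thesis using main[of "\<lambda>e. - y e"] y by (simp add: sum_negf)
  qed
qed

section \<open>Vertices of degree one and two\<close>

text \<open>The only edge at \<open>v\<close> has value 1 and so uses up the degree of its other end
  \<open>a\<close>. Positivity excludes further edges at \<open>a\<close>, and both ends can be
  removed.\<close>

lemma dominates_pm_leaf:
  fixes V :: "'v set" and E :: "'e set"
  assumes f: "fractional_pm V E ends x" and v: "v \<in> V" "ecut ends E {v} = {e}"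
    and IH: "\<And>(V' :: 'v set) (E' :: 'e set) ends' x'. card V' + card E' < card V + card E \<Longrightarrow>
        fractional_pm V' E' ends' x' \<Longrightarrow> dominates_pm V' E' ends' x'"
  shows "dominates_pm V E ends x"
  unfolding dominates_pm_def
proof
  fix w :: "'e \<Rightarrow> real"
  note F = f[unfolded fractional_pm_def]
  have inc: "e' \<in> ecut ends E {u} \<longleftrightarrow> e' \<in> E \<and> u \<in> ends e'" for e' u
  proof (cases "e' \<in> E")
    case True
    then show ?thesis using F by (simp add: ecut_singleton)
  qed (simp add: ecut_def)
  have eE: "e \<in> E" "v \<in> ends e" using inc[of e v] v(2) by auto
  have e2: "card (ends e) = 2" using F eE by auto
  obtain a where a: "a \<noteq> v" "ends e = {v, a}" using card_2_obtain[OF e2 eE(2)] by metis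
  have "sum x (ecut ends E {v}) = 1" using F v(1) by blast
  then have xe: "x e = 1" unfolding v(2) by simp
  have aV: "a \<in> V" using F eE a by auto
  have cuta: "ecut ends E {a} = {e}"
  proof -
    have e: "e \<in> ecut ends E {a}" using inc eE a by simp
    have fin: "finite (ecut ends E {a})" using F finite_ecut by blast
    have "sum x (ecut ends E {a} - {e}) = 0"
      using F aV sum.remove[OF fin e, of x] xe by simp
    moreover have "\<forall>e'\<in>ecut ends E {a} - {e}. x e' > 0" using F by (simp add: inc)
    ultimately have "ecut ends E {a} - {e} = {}"
      using fin by (metis finite_Diff less_irrefl sum_pos)
    then show ?thesis using e by blast
  qed
  define V' where "V' = V - {v, a}"
  define E' where "E' = E - {e}"
  have E'ends: "v \<notin> ends e'" "a \<notin> ends e'" if "e' \<in> E'" for e'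
    using that inc[of e' v] inc[of e' a] v(2) cuta by (auto simp: E'_def)
  have E'E: "\<And>e'. e' \<in> E' \<Longrightarrow> e' \<in> E" by (simp add: E'_def)
  have cutE': "ecut ends E' U = ecut ends E U" if "U \<subseteq> V'" for U
  proof -
    have "e \<notin> ecut ends E U" using a(2) that by (auto simp: ecut_def V'_def)
    then show ?thesis by (auto simp: ecut_def E'_def)
  qed
  have fin: "finite V" "finite E" using F by auto
  have "fractional_pm V' E' ends x"
    unfolding fractional_pm_def
  proof (intro conjI ballI allI impI)
    show "finite V'" "finite E'" using fin by (auto simp: V'_def E'_def)
    fix e' assume "e' \<in> E'"
    then have "e' \<in> E" and "v \<notin> ends e'" "a \<notin> ends e'" using E'ends by (auto simp: E'_def)
    then show "ends e' \<subseteq> V'" "card (ends e') = 2" "x e' > 0" using F by (auto simp: V'_def)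
  next
    fix u assume "u \<in> V'"
    then show "sum x (ecut ends E' {u}) = 1" using F by (subst cutE') (auto simp: V'_def)
  next
    fix U assume U: "U \<subseteq> V'" "odd (card U)"
    then have "U \<subseteq> V" by (auto simp: V'_def)
    then show "1 \<le> sum x (ecut ends E' U)" using F U by (simp add: cutE')
  qed
  moreover have "card E' < card E" "card V' \<le> card V"
    using eE fin by (auto simp: E'_def V'_def card_Diff1_less intro: card_mono simp del: card_Diff_insert)
  ultimately have "dominates_pm V' E' ends x" by (intro IH) auto
  then obtain M where M: "perfect_matching V' E' ends M" "sum w M \<le> (\<Sum>e\<in>E'. w e * x e)"
    unfolding dominates_pm_def by blast
  have ME: "M \<subseteq> E'" using M(1) by (simp add: perfect_matching_def)
  have incM: "e' \<in> ecut ends (insert e M) {u} \<longleftrightarrow> e' \<in> insert e M \<and> u \<in> ends e'" for e' u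
    using inc[of e' u] ME eE by (auto simp: ecut_def E'_def)
  have "card (ecut ends (insert e M) {u}) = 1" if "u \<in> V" for u
  proof (cases "u \<in> V'")
    case True
    then have "u \<notin> ends e" using a by (simp add: V'_def)
    then have "ecut ends (insert e M) {u} = ecut ends M {u}" by (auto simp: ecut_def)
    then show ?thesis using M(1) True by (simp add: perfect_matching_def)
  next
    case False
    then have "u = v \<or> u = a" using that by (simp add: V'_def)
    then have "ecut ends (insert e M) {u} = {e}"
      using incM ME E'ends a(2) by blast
    then show ?thesis by simp
  qed
  then have "perfect_matching V E ends (insert e M)"
    using ME eE by (auto simp: perfect_matching_def E'_def)
  moreover have "sum w (insert e M) \<le> (\<Sum>e\<in>E. w e * x e)"
  proof -
    have "finite M" "e \<notin> M" using ME fin by (auto simp: E'_def intro: finite_subset)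
    then have "sum w (insert e M) = w e + sum w M" by simp
    also have "\<dots> \<le> w e * x e + (\<Sum>e\<in>E'. w e * x e)" using M(2) xe by simp
    also have "\<dots> = (\<Sum>e\<in>E. w e * x e)"
      unfolding E'_def using fin eE by (simp add: sum.remove)
    finally show ?thesis .
  qed
  ultimately show "\<exists>M. perfect_matching V E ends M \<and> sum w M \<le> (\<Sum>e\<in>E. w e * x e)" by blast
qed

lemma sum_pos_zero_empty:
  fixes x :: "'e \<Rightarrow> real"
  assumes "finite A" "\<forall>e\<in>A. x e > 0" "sum x A \<le> 0"
  shows "A = {}"
  using assms sum_pos[of A x] by force

text \<open>If \<open>v\<close> has only the neighbours \<open>a\<close> and \<open>b\<close>, then \<open>{v, a, b}\<close> is a tight odd set, and a
  perfect matching of the contracted graph extends by the edge from \<open>v\<close> to the vertex left over.\<close>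

lemma dominates_pm_degree_2:
  fixes V :: "'v set" and E :: "'e set"
  assumes f: "fractional_pm V E ends x" and v: "v \<in> V" "ecut ends E {v} = {e, g}" "e \<noteq> g"
    and eg: "ends e = {v, a}" "ends g = {v, b}" "a \<noteq> b"
    and IH: "\<And>(V' :: 'v set) (E' :: 'e set) ends' x'. card V' + card E' < card V + card E \<Longrightarrow>
        fractional_pm V' E' ends' x' \<Longrightarrow> dominates_pm V' E' ends' x'"
  shows "dominates_pm V E ends x"
  unfolding dominates_pm_def
proof
  fix w :: "'e \<Rightarrow> real"
  note F = f[unfolded fractional_pm_def]
  have inc: "k \<in> ecut ends E {u} \<longleftrightarrow> k \<in> E \<and> u \<in> ends k" for k u
  proof (cases "k \<in> E")
    case True
    then show ?thesis using F by (simp add: ecut_singleton)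
  qed (simp add: ecut_def)
  have fin: "finite V" "finite E" and fincut: "finite (ecut ends E W)" for W
    using F finite_ecut by auto
  have xpos: "x k > 0" if "k \<in> E" for k using F that by blast
  have xcut: "sum x (ecut ends E {u}) = 1" if "u \<in> V" for u using F that by blast
  have eE: "e \<in> E" "g \<in> E" using v(2) inc[of e v] inc[of g v] by auto
  have vends: "k = e \<or> k = g" if "k \<in> E" "v \<in> ends k" for k
    using inc[of k v] that v(2) by auto
  have neq: "a \<noteq> v" "b \<noteq> v" using F eE eg by force+
  have abV: "a \<in> V" "b \<in> V" using F eE eg by auto
  define U where "U = {v, a, b}"
  have U: "U \<subseteq> V" "card U = 3" "v \<in> U" using neq eg(3) abV v(1) by (auto simp: U_def)
  define A where "A = ecut ends E {a} - {e}"
  define B where "B = ecut ends E {b} - {g}"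
  define K where "K = ecut ends E U"
  have finA: "finite A" "finite B" "finite K" using fincut by (auto simp: A_def B_def K_def)
  have A_iff: "k \<in> A \<longleftrightarrow> k \<in> E \<and> a \<in> ends k \<and> k \<noteq> e" for k by (auto simp: A_def inc)
  have B_iff: "k \<in> B \<longleftrightarrow> k \<in> E \<and> b \<in> ends k \<and> k \<noteq> g" for k by (auto simp: B_def inc)
  have xA: "sum x A = 1 - x e" using sum.remove[OF fincut, of e "{a}" x] xcut[OF abV(1)] inc eE eg
    by (simp add: A_def)
  have xB: "sum x B = 1 - x g" using sum.remove[OF fincut, of g "{b}" x] xcut[OF abV(2)] inc eE eg
    by (simp add: B_def)
  have xeg: "x e + x g = 1" using xcut[OF v(1)] v(2,3) by simp
  have KAB: "K \<subseteq> A \<union> B"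
  proof
    fix k assume "k \<in> K"
    then have k: "k \<in> E" "ends k \<inter> U \<noteq> {}" "\<not> ends k \<subseteq> U" by (auto simp: K_def ecut_def)
    then have "k \<noteq> e" "k \<noteq> g" using eg by (auto simp: U_def)
    moreover then have "v \<notin> ends k" using vends k(1) by blast
    then have "a \<in> ends k \<or> b \<in> ends k" using k(2) by (auto simp: U_def)
    ultimately show "k \<in> A \<union> B" using k(1) A_iff B_iff by blast
  qed
  \<comment> \<open>The sums over \<open>A\<close> and \<open>B\<close> add up to 1, and the cut
    \<open>K\<close> inside their union already needs 1. By positivity \<open>A\<close> and
    \<open>B\<close> are disjoint and together equal to \<open>K\<close>, which makes
    \<open>U\<close> tight.\<close>
  have "sum x K \<ge> 1" using F U by (simp add: K_def)
  moreover have un: "sum x (A \<union> B) = 1 - sum x (A \<inter> B)"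
    using sum.union_inter[OF finA(1,2), of x] xA xB xeg by linarith
  moreover have "sum x (A \<union> B) = sum x K + sum x (A \<union> B - K)"
    using finA KAB by (metis add.commute finite_UnI sum.subset_diff)
  moreover have pos: "\<forall>k\<in>A \<inter> B. x k > 0" "\<forall>k\<in>A \<union> B - K. x k > 0"
    using xpos A_iff B_iff by blast+
  moreover have "sum x (A \<inter> B) \<ge> 0" "sum x (A \<union> B - K) \<ge> 0"
    using pos by (meson sum_nonneg less_imp_le)+
  ultimately have "sum x (A \<inter> B) \<le> 0" "sum x (A \<union> B - K) \<le> 0" by linarith+
  then have "A \<inter> B = {}" "A \<union> B - K = {}"
    using sum_pos_zero_empty[of "A \<inter> B" x] sum_pos_zero_empty[of "A \<union> B - K" x] pos finA by auto
  then have AB: "A \<inter> B = {}" and K: "K = A \<union> B" using KAB by auto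
  have tight: "sum x (ecut ends E U) = 1" using un AB K by (simp add: K_def)
  define E1 where "E1 = {k \<in> E. \<not> ends k \<subseteq> U}"
  have KE1: "K \<subseteq> E1" by (auto simp: K_def E1_def ecut_def)
  have egE1: "e \<notin> E1" "g \<notin> E1" using eg by (auto simp: E1_def U_def)
  have E: "E = insert e (insert g E1)"
  proof -
    have "k = e \<or> k = g" if k: "k \<in> E" "ends k \<subseteq> U" for k
    proof (rule ccontr)
      assume n: "\<not> (k = e \<or> k = g)"
      then have "ends k \<subseteq> {a, b}" using vends k by (auto simp: U_def)
      moreover have "card (ends k) = 2" using F k by blast
      ultimately have "ends k = {a, b}" using eg(3) by (intro card_subset_eq) auto
      then have "k \<in> A \<inter> B" using A_iff B_iff n k(1) by simp
      then show False using AB by simp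
    qed
    then show ?thesis using eE by (auto simp: E1_def)
  qed
  have "dominates_pm_mod V E ends x U"
  proof (rule dominates_pm_contract[OF IH _ ])
    show "fractional_pm (insert v (V - U)) {e \<in> E. \<not> ends e \<subseteq> U} (contract U v ends) x"
      using U by (intro fractional_pm_contract[OF f] tight) auto
    have "card U \<le> card V" using U fin by (intro card_mono) auto
    then have "card (insert v (V - U)) < card V"
      using U fin finite_subset[OF U(1)] by (simp add: card_Diff_subset)
    moreover have "card {e \<in> E. \<not> ends e \<subseteq> U} \<le> card E" using fin by (intro card_mono) auto
    ultimately show "card (insert v (V - U)) + card {e \<in> E. \<not> ends e \<subseteq> U} < card V + card E"
      by linarith
  qed (rule U(3))
  \<comment> \<open>A cut edge in \<open>A\<close> covers \<open>a\<close> and leaves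
    \<open>b\<close> to be matched by \<open>g\<close>, so it is charged \<open>w g\<close>;
    symmetrically in \<open>B\<close>. The charges add up correctly because \<open>A\<close> has
    total value \<open>1 - x e = x g\<close> and \<open>B\<close> has \<open>x e\<close>.\<close>
  define w1 where "w1 k = w k + (if k \<in> A then w g else if k \<in> B then w e else 0)" for k
  obtain M1 where M1: "M1 \<subseteq> E1" "\<And>u. u \<in> V - U \<Longrightarrow> card (ecut ends M1 {u}) = 1"
      "card (ecut ends M1 U) = 1" "sum w1 M1 \<le> (\<Sum>k\<in>E1. w1 k * x k)"
    using \<open>dominates_pm_mod V E ends x U\<close>[unfolded dominates_pm_mod_def E1_def[symmetric], rule_format, of w1]
    by blast
  have M1E: "M1 \<subseteq> E" using M1(1) by (auto simp: E1_def)
  have finM1: "finite M1" "finite E1" using M1E fin finite_subset by (auto simp: E1_def)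
  have "ecut ends M1 U = M1 \<inter> K" using M1E by (auto simp: K_def ecut_def)
  then obtain k where k: "M1 \<inter> K = {k}" using M1(3) by (auto simp: card_1_singleton_iff)
  define c where "c = (if k \<in> A then g else e)"
  let ?M = "insert c M1"
  have cM1: "c \<notin> M1" using egE1 M1(1) by (auto simp: c_def)
  have cE: "c \<in> E" using eE by (simp add: c_def)
  have incM: "h \<in> ecut ends ?M {u} \<longleftrightarrow> (h = c \<or> h \<in> M1) \<and> u \<in> ends h" for h u
    using inc[of h u] M1E cE by (auto simp: ecut_def)
  have MK: "h = k" if "h \<in> M1" "h \<in> A \<union> B" for h
  proof -
    have "h \<in> M1 \<inter> K" using that K by simp
    then show ?thesis by (simp only: k singleton_iff)
  qed
  have M1A: "h \<in> M1 \<Longrightarrow> a \<in> ends h \<longleftrightarrow> h = k \<and> k \<in> A" for h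
  proof -
    assume h: "h \<in> M1"
    then have "h \<noteq> e" "h \<in> E" using M1(1) egE1 M1E by blast+
    then have "a \<in> ends h \<longleftrightarrow> h \<in> A" by (simp add: A_iff)
    also have "\<dots> \<longleftrightarrow> h = k \<and> k \<in> A" using MK[OF h] by blast
    finally show ?thesis .
  qed
  have M1B: "h \<in> M1 \<Longrightarrow> b \<in> ends h \<longleftrightarrow> h = k \<and> k \<in> B" for h
  proof -
    assume h: "h \<in> M1"
    then have "h \<noteq> g" "h \<in> E" using M1(1) egE1 M1E by blast+
    then have "b \<in> ends h \<longleftrightarrow> h \<in> B" by (simp add: B_iff)
    also have "\<dots> \<longleftrightarrow> h = k \<and> k \<in> B" using MK[OF h] by blast
    finally show ?thesis .
  qed
  have kM1: "k \<in> M1" and kAB: "k \<in> A \<longleftrightarrow> k \<notin> B"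
  proof -
    have "k \<in> M1 \<inter> K" by (simp only: k singleton_iff)
    then show "k \<in> M1" "k \<in> A \<longleftrightarrow> k \<notin> B" using K AB by auto
  qed
  have "card (ecut ends ?M {u}) = 1" if u: "u \<in> V" for u
  proof -
    consider "u \<notin> U" | "u = v" | "u = a" | "u = b" by (auto simp: U_def)
    then show ?thesis
    proof cases
      case 1
      then have "u \<notin> ends c" using eg by (auto simp: c_def U_def)
      then have "ecut ends ?M {u} = ecut ends M1 {u}" by (auto simp: ecut_def)
      then show ?thesis using M1(2) u 1 by simp
    next
      case 2
      have "v \<notin> ends h" if "h \<in> M1" for h
        using vends[of h] that M1E M1(1) egE1 by blast
      then have "ecut ends ?M {u} = {c}" using 2 incM eg by (auto simp: c_def)
      then show ?thesis by simp
    next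
      case 3
      have "a \<in> ends c \<longleftrightarrow> k \<notin> A" using eg neq by (simp add: c_def)
      then have "h \<in> ecut ends ?M {a} \<longleftrightarrow> h = (if k \<in> A then k else c)" for h
        using incM[of h a] M1A[of h] kM1 by auto
      then have "ecut ends ?M {u} = {if k \<in> A then k else c}" using 3 by blast
      then show ?thesis by simp
    next
      case 4
      have "b \<in> ends c \<longleftrightarrow> k \<notin> B" using eg neq kAB by (simp add: c_def)
      then have "h \<in> ecut ends ?M {b} \<longleftrightarrow> h = (if k \<in> B then k else c)" for h
        using incM[of h b] M1B[of h] kM1 by auto
      then have "ecut ends ?M {u} = {if k \<in> B then k else c}" using 4 by blast
      then show ?thesis by simp
    qed
  qed
  then have "perfect_matching V E ends ?M" using M1E cE by (simp add: perfect_matching_def)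
  moreover have "sum w ?M \<le> (\<Sum>k\<in>E. w k * x k)"
  proof -
    let ?h = "\<lambda>k. if k \<in> A then w g else if k \<in> B then w e else 0"
    have "sum ?h M1 = sum ?h {k}"
      using finM1 k K by (intro sum.mono_neutral_right) auto
    also have "\<dots> = w c" using kAB by (simp add: c_def)
    finally have "sum w ?M = sum w1 M1"
      using cM1 finM1 by (simp add: w1_def sum.distrib)
    also have "\<dots> \<le> (\<Sum>k\<in>E1. w1 k * x k)" by (rule M1(4))
    also have "\<dots> = (\<Sum>k\<in>E1. w k * x k) + (\<Sum>k\<in>E1. ?h k * x k)"
      by (simp add: w1_def sum.distrib ring_distribs)
    also have "(\<Sum>k\<in>E1. ?h k * x k) = (\<Sum>k\<in>K. ?h k * x k)"
      using finM1 KE1 K by (intro sum.mono_neutral_right) auto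
    also have "\<dots> = (\<Sum>k\<in>A. ?h k * x k) + (\<Sum>k\<in>B. ?h k * x k)"
      unfolding K using finA AB by (intro sum.union_disjoint)
    also have "(\<Sum>k\<in>A. ?h k * x k) = w g * sum x A" by (simp add: sum_distrib_left)
    also have "(\<Sum>k\<in>B. ?h k * x k) = (\<Sum>k\<in>B. w e * x k)"
      using AB by (intro sum.cong) auto
    also have "\<dots> = w e * sum x B" by (simp add: sum_distrib_left)
    also have "sum x A = x g" using xA xeg by simp
    also have "sum x B = x e" using xB xeg by simp
    also have "(\<Sum>k\<in>E1. w k * x k) + (w g * x g + w e * x e) = (\<Sum>k\<in>E. w k * x k)"
      unfolding E using egE1 finM1 v(3) by simp
    finally show ?thesis .
  qed
  ultimately show "\<exists>M. perfect_matching V E ends M \<and> sum w M \<le> (\<Sum>k\<in>E. w k * x k)" by blast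
qed

text \<open>If every vertex has at least three edges, double counting gives more edges than
  vertices. The degree equations then have fewer equations than variables, and a kernel vector
  exists.\<close>

theorem edmonds_perfect_matching:
  fixes V :: "'v set" and E :: "'e set"
  assumes "fractional_pm V E ends x"
  shows "dominates_pm V E ends x"
  using assms
proof (induction "card V + card E" arbitrary: V E ends x rule: less_induct)
  case less
  note f = less(2) and F = less(2)[unfolded fractional_pm_def]
  have IH: "dominates_pm V' E' ends' x'"
    if "card V' + card E' < card V + card E" "fractional_pm V' E' ends' x'"
    for V' :: "'v set" and E' :: "'e set" and ends' x'
    using less(1) that by blast
  have inc: "k \<in> ecut ends E {u} \<longleftrightarrow> k \<in> E \<and> u \<in> ends k" for k u
  proof (cases "k \<in> E")
    case True
    then show ?thesis using F by (simp add: ecut_singleton)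
  qed (simp add: ecut_def)
  have fin: "finite V" "finite E" and fincut: "finite (ecut ends E W)" for W
    using F finite_ecut by auto
  have small: "(m :: nat) \<le> 1 \<or> m = 2 \<or> m \<ge> 3" for m by linarith
  consider "V = {}" | v where "v \<in> V" "card (ecut ends E {v}) \<le> 1"
    | v where "v \<in> V" "card (ecut ends E {v}) = 2"
    | "V \<noteq> {}" "\<And>v. v \<in> V \<Longrightarrow> card (ecut ends E {v}) \<ge> 3"
    using small by blast
  then show ?case
  proof cases
    case 1
    have "E = {}"
    proof (rule ccontr)
      assume "E \<noteq> {}"
      then obtain e where "e \<in> E" by blast
      then have "card (ends e) = 2" "ends e \<subseteq> {}" using F 1 by auto
      then show False by simp
    qed
    then show ?thesis using 1 by (simp add: dominates_pm_def perfect_matching_def)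
  next
    case (2 v)
    have "ecut ends E {v} \<noteq> {}" using F 2(1) by force
    then have "card (ecut ends E {v}) = 1" using 2(2) fincut card_0_eq[OF fincut] 
      by (metis le_neq_implies_less less_one)
    then obtain e where "ecut ends E {v} = {e}" by (auto simp: card_1_singleton_iff)
    then show ?thesis using dominates_pm_leaf[OF f 2(1)] IH by blast
  next
    case (3 v)
    obtain e g where eg: "ecut ends E {v} = {e, g}" "e \<noteq> g" using 3(2) by (meson card_2_iff)
    then have eE: "e \<in> E" "v \<in> ends e" "g \<in> E" "v \<in> ends g"
      using inc[of e v] inc[of g v] by auto
    have c2: "card (ends e) = 2" "card (ends g) = 2" using F eE by auto
    obtain a where a: "a \<noteq> v" "ends e = {v, a}" using card_2_obtain[OF c2(1) eE(2)] by metis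
    obtain b where b: "b \<noteq> v" "ends g = {v, b}" using card_2_obtain[OF c2(2) eE(4)] by metis
    show ?thesis
    proof (cases "a = b")
      case False
      then show ?thesis using dominates_pm_degree_2[OF f 3(1) eg a(2) b(2)] IH by blast
    next
      case True
      \<comment> \<open>Two parallel edges at \<open>v\<close>: shifting value from one to the other
        changes no degree.\<close>
      define y :: "'e \<Rightarrow> real" where "y k = (if k = e then 1 else 0) - (if k = g then 1 else 0)" for k
      have "sum y (ecut ends E {u}) = 0" for u
        using fincut[of "{u}"] a b True inc eE by (simp add: y_def sum_subtractf)
      moreover have "y e \<noteq> 0" using eg by (simp add: y_def)
      ultimately show ?thesis using dominates_pm_kernel[OF f _ eE(1), of y] IH by blast
    qed
  next
    case 4
    have cut: "ecut ends E {v} = {e \<in> E. v \<in> ends e}" for v using inc by blast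
    have ce: "{v \<in> V. v \<in> ends e} = ends e" if "e \<in> E" for e using F that by auto
    have "3 * card V \<le> (\<Sum>v\<in>V. card (ecut ends E {v}))"
      using sum_mono[of V "\<lambda>_. 3" "\<lambda>v. card (ecut ends E {v})"] 4(2) by simp
    also have "\<dots> = (\<Sum>v\<in>V. \<Sum>e\<in>E. if v \<in> ends e then 1 else 0)"
      unfolding cut using fin by (simp add: sum.If_cases Int_def)
    also have "\<dots> = (\<Sum>e\<in>E. \<Sum>v\<in>V. if v \<in> ends e then 1 else 0)" by (rule sum.swap)
    also have "\<dots> = (\<Sum>e\<in>E. card {v \<in> V. v \<in> ends e})"
      using fin by (simp add: sum.If_cases Int_def)
    also have "\<dots> = (\<Sum>e\<in>E. 2)" using F ce by (intro sum.cong) auto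
    finally have "3 * card V \<le> 2 * card E" by simp
    moreover have "card V > 0" using 4(1) fin by (simp add: card_gt_0_iff)
    ultimately have "card V < card E" by linarith
    then obtain y where y: "\<exists>e\<in>E. y e \<noteq> 0"
        "\<forall>v\<in>V. (\<Sum>e\<in>E. (if v \<in> ends e then 1 else 0) * y e) = (0 :: real)"
      using homogeneous_solution[OF fin, of "\<lambda>v e. if v \<in> ends e then 1 else 0"] by blast
    have "sum y (ecut ends E {v}) = 0" if "v \<in> V" for v
    proof -
      have "sum y (ecut ends E {v}) = (\<Sum>e\<in>E. if v \<in> ends e then y e else 0)"
        unfolding cut using fin by (simp add: sum.If_cases Int_def)
      also have "\<dots> = (\<Sum>e\<in>E. (if v \<in> ends e then 1 else 0) * y e)" by (intro sum.cong) auto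
      finally show ?thesis using y(2) that by simp
    qed
    then show ?thesis using y(1) dominates_pm_kernel[OF f] IH by blast
  qed
qed

subsection \<open>Bridgeless subcubic graphs\<close>

text \<open>An edge inside \<open>W\<close> contributes 2 to the degree sum, an edge across
  contributes 1.\<close>

lemma even_degree_sum_iff_even_cut:
  assumes "finite H" "\<forall>e\<in>H. card e = 2" "finite W"
  shows "even (\<Sum>v\<in>W. card {e \<in> H. v \<in> e}) \<longleftrightarrow> even (card (bd H W))"
proof -
  have "(\<Sum>v\<in>W. card {e \<in> H. v \<in> e}) = (\<Sum>v\<in>W. \<Sum>e\<in>H. if v \<in> e then 1 else 0)"
    using assms by (simp add: sum.If_cases Int_def)
  also have "\<dots> = (\<Sum>e\<in>H. \<Sum>v\<in>W. if v \<in> e then 1 else 0)" by (rule sum.swap)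
  also have "\<dots> = (\<Sum>e\<in>H. card (e \<inter> W))"
    using assms by (simp add: sum.If_cases Int_commute)
  finally have "even (\<Sum>v\<in>W. card {e \<in> H. v \<in> e}) \<longleftrightarrow> even (card {e \<in> H. odd (card (e \<inter> W))})"
    using assms(1) by (simp add: even_sum_iff)
  also have "{e \<in> H. odd (card (e \<inter> W))} = bd H W"
  proof -
    have "odd (card (e \<inter> W)) \<longleftrightarrow> e \<inter> W \<noteq> {} \<and> \<not> e \<subseteq> W" if "e \<in> H" for e
    proof -
      have "card e = 2" using assms(2) that by blast
      then obtain a b where "e = {a, b}" "a \<noteq> b" unfolding card_2_iff by blast
      then show ?thesis by (cases "a \<in> W"; cases "b \<in> W") auto
    qed
    then show ?thesis by (auto simp: ecut_def)
  qed
  finally show ?thesis .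
qed

text \<open>Edmonds' theorem is applied to the graph in which every vertex \<open>v\<close> of degree 2 is replaced by
  two vertices joined by a new edge: that edge gets the value 2/3, all others 1/3.\<close>

lemma light_parity_factor:
  fixes H :: "'a set set" and w :: "'a set \<Rightarrow> real"
  assumes finV: "finite V" and H: "\<forall>e\<in>H. card e = 2 \<and> e \<subseteq> V"
    and deg: "\<forall>v\<in>V. card {e \<in> H. v \<in> e} \<in> {0, 2, 3}"
    and bridgeless: "\<And>W. card (bd H W) \<noteq> 1"
  shows "\<exists>F\<subseteq>H. (\<forall>v\<in>V. card {e \<in> H. v \<in> e} = 3 \<longrightarrow> card {e \<in> F. v \<in> e} = 1) \<and>
    (\<forall>v\<in>V. card {e \<in> H. v \<in> e} = 2 \<longrightarrow> even (card {e \<in> F. v \<in> e})) \<and>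
    sum w F \<le> sum w H / 3"
proof -
  have finH: "finite H" using H finV by (auto intro: finite_subset[of _ "Pow V"])
  define D2 where "D2 = {v \<in> V. card {e \<in> H. v \<in> e} = 2}"
  define D3 where "D3 = {v \<in> V. card {e \<in> H. v \<in> e} = 3}"
  have finD: "finite D2" "finite D3" "D2 \<inter> D3 = {}" using finV by (auto simp: D2_def D3_def)
  have endsD: "v \<in> D2 \<union> D3" if "e \<in> H" "v \<in> e" for e v
  proof -
    have "v \<in> V" "{e \<in> H. v \<in> e} \<noteq> {}" using that H by auto
    then have "card {e \<in> H. v \<in> e} \<noteq> 0" using finH by simp
    then show ?thesis using deg \<open>v \<in> V\<close> by (auto simp: D2_def D3_def)
  qed
  have "\<forall>v\<in>D2. \<exists>g f. {e \<in> H. v \<in> e} = {g, f} \<and> g \<noteq> f" by (auto simp: D2_def card_2_iff)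
  then obtain g f where gf: "\<And>v. v \<in> D2 \<Longrightarrow> {e \<in> H. v \<in> e} = {g v, f v}" "\<And>v. v \<in> D2 \<Longrightarrow> g v \<noteq> f v"
    by metis
  \<comment> \<open>Of the two edges at \<open>v\<close>, \<open>g v\<close> is attached to the copy
    \<open>(v, True)\<close> and \<open>f v\<close> to \<open>(v, False)\<close>. A perfect matching
    then contains either the new edge \<open>Inr v\<close> or both \<open>g v\<close> and
    \<open>f v\<close>, which is the even parity wanted at \<open>v\<close>.\<close>
  define tag where "tag e v \<longleftrightarrow> v \<in> D2 \<and> e = g v" for e v
  define ends where "ends = case_sum (\<lambda>e. (\<lambda>v. (v, tag e v)) ` e) (\<lambda>v. {(v, False), (v, True)})"
  define V' where "V' = (\<lambda>v. (v, False)) ` (D2 \<union> D3) \<union> (\<lambda>v. (v, True)) ` D2"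
  define E' where "E' = Inl ` H \<union> Inr ` D2"
  define x :: "'a set + 'a \<Rightarrow> real" where "x = case_sum (\<lambda>_. 1 / 3) (\<lambda>_. 2 / 3)"
  have endsL: "(v, t) \<in> ends (Inl e) \<longleftrightarrow> v \<in> e \<and> t = tag e v" for v t e
    by (auto simp: ends_def)
  have endsR: "(v, t) \<in> ends (Inr u) \<longleftrightarrow> v = u" for v t u
    by (auto simp: ends_def)
  have fin': "finite V'" "finite E'" using finD finH by (auto simp: V'_def E'_def)
  have ends': "ends k \<subseteq> V' \<and> card (ends k) = 2 \<and> x k > 0" if "k \<in> E'" for k
  proof (cases k)
    case (Inl e)
    then have e: "e \<in> H" using that by (auto simp: E'_def)
    have "card (ends k) = card e" unfolding Inl ends_def by (auto intro!: card_image inj_onI)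
    moreover have "ends k \<subseteq> V'"
      using endsD[OF e] by (auto simp: Inl ends_def V'_def tag_def)
    ultimately show ?thesis using H e by (simp add: Inl x_def)
  next
    case (Inr v)
    then show ?thesis using that by (auto simp: ends_def V'_def E'_def x_def)
  qed
  have inc: "k \<in> ecut ends M {p} \<longleftrightarrow> k \<in> M \<and> p \<in> ends k" if "M \<subseteq> E'" for k M p
  proof (cases "k \<in> M")
    case True
    then show ?thesis using ends'[of k] that by (simp add: ecut_singleton subsetD)
  qed (simp add: ecut_def)
  have cut3: "ecut ends M {(v, False)} = Inl ` {e. Inl e \<in> M \<and> v \<in> e}"
    if "M \<subseteq> E'" "v \<in> D3" for M v
  proof -
    have "k \<in> ecut ends M {(v, False)} \<longleftrightarrow> k \<in> Inl ` {e. Inl e \<in> M \<and> v \<in> e}" for k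
      using finD(3) that by (cases k) (auto simp: inc[OF that(1)] endsL endsR tag_def E'_def)
    then show ?thesis by blast
  qed
  have cut2: "ecut ends M {(v, True)} = M \<inter> {Inl (g v), Inr v}"
    "ecut ends M {(v, False)} = M \<inter> {Inl (f v), Inr v}" if "M \<subseteq> E'" "v \<in> D2" for M v
  proof -
    have e: "v \<in> e \<longleftrightarrow> e = g v \<or> e = f v" if "Inl e \<in> M" for e
      using gf(1)[OF \<open>v \<in> D2\<close>] \<open>M \<subseteq> E'\<close> that by (auto simp: E'_def)
    have "k \<in> ecut ends M {(v, True)} \<longleftrightarrow> k \<in> M \<inter> {Inl (g v), Inr v}" for k
      using that e by (cases k) (auto simp: inc[OF that(1)] endsL endsR tag_def)
    then show "ecut ends M {(v, True)} = M \<inter> {Inl (g v), Inr v}" by blast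
    have "k \<in> ecut ends M {(v, False)} \<longleftrightarrow> k \<in> M \<inter> {Inl (f v), Inr v}" for k
      using that e gf(2)[OF that(2)] by (cases k) (auto simp: inc[OF that(1)] endsL endsR tag_def)
    then show "ecut ends M {(v, False)} = M \<inter> {Inl (f v), Inr v}" by blast
  qed
  have gfH: "g v \<in> H" "f v \<in> H" "v \<in> g v" if "v \<in> D2" for v using gf(1)[OF that] by auto
  have sum1: "sum x (ecut ends E' {p}) = 1" if p: "p \<in> V'" for p
  proof -
    obtain v t where vt: "p = (v, t)" by (cases p)
    consider "v \<in> D3" "t = False" | "v \<in> D2" "t = False" | "v \<in> D2" "t = True"
      using p vt by (auto simp: V'_def)
    then show ?thesis
    proof cases
      case 1
      have "{e. Inl e \<in> E' \<and> v \<in> e} = {e \<in> H. v \<in> e}" by (auto simp: E'_def)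
      then show ?thesis using cut3[of E' v] 1 vt
        by (simp add: sum.reindex x_def D3_def)
    next
      case 2
      have "E' \<inter> {Inl (f v), Inr v} = {Inl (f v), Inr v}" using gfH 2 by (auto simp: E'_def)
      then show ?thesis using cut2(2)[of E' v] 2 vt by (simp add: x_def)
    next
      case 3
      have "E' \<inter> {Inl (g v), Inr v} = {Inl (g v), Inr v}" using gfH 3 by (auto simp: E'_def)
      then show ?thesis using cut2(1)[of E' v] 3 vt by (simp add: x_def)
    qed
  qed
  have sumU: "sum x (ecut ends E' U) \<ge> 1" if U: "U \<subseteq> V'" "odd (card U)" for U
  proof -
    define C where "C = ecut ends E' U"
    define W where "W = {u. (u, False) \<in> U}"
    have finC: "finite C" using fin' by (auto simp: C_def ecut_def)
    have WD: "W \<subseteq> D2 \<union> D3" using U(1) by (auto simp: W_def V'_def)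
    have CR: "Inr u \<in> C \<longleftrightarrow> u \<in> D2 \<and> (u \<in> W \<longleftrightarrow> (u, True) \<notin> U)" for u
      by (auto simp: C_def E'_def ecut_def ends_def W_def)
    have CL: "Inl e \<in> C \<longleftrightarrow> e \<in> H \<and> (\<exists>v\<in>e. (v, tag e v) \<in> U) \<and> (\<exists>v\<in>e. (v, tag e v) \<notin> U)" for e
      by (auto simp: C_def E'_def ecut_alt ends_def)
    show ?thesis
    proof (cases "\<exists>v. Inr v \<in> C")
      case True
      then obtain v where v: "Inr v \<in> C" by blast
      \<comment> \<open>A cut new edge contributes 2/3, so one further edge is enough. If it were
        alone, its two copies would be separated while \<open>g v\<close> is not cut; with
        \<open>v\<close> placed by its copy \<open>(v, False)\<close>, exactly \<open>g v\<close>
        would be cut in \<open>H\<close>, against bridgelessness.\<close>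
      have "C \<noteq> {Inr v}"
      proof
        assume only: "C = {Inr v}"
        have v2: "v \<in> D2" "v \<in> W \<longleftrightarrow> (v, True) \<notin> U" using v CR by auto
        have same: "(u, tag e u) \<in> U \<longleftrightarrow> (if e = g v \<and> u = v then u \<notin> W else u \<in> W)"
          if "u \<in> e" "e \<in> H" for u e
        proof (cases "tag e u")
          case True
          then have "u \<in> D2" "e = g u" by (auto simp: tag_def)
          moreover have "Inr u \<in> C \<longleftrightarrow> u = v" using only by auto
          ultimately show ?thesis using True CR[of u] by auto
        next
          case False
          then have "(u, tag e u) = (u, False)" by simp
          moreover have "\<not> (e = g v \<and> u = v)" using False v2(1) unfolding tag_def by blast
          ultimately show ?thesis by (simp add: W_def)
        qed
        have "bd H W = {g v}"
        proof (intro set_eqI iffI)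
          fix e assume e: "e \<in> bd H W"
          show "e \<in> {g v}"
          proof (rule ccontr)
            assume "e \<notin> {g v}"
            then have "Inl e \<in> C" using e same[of _ e] by (auto simp: CL ecut_alt)
            then show False using only by simp
          qed
        next
          fix e assume "e \<in> {g v}"
          then have e: "e = g v" "e \<in> H" "v \<in> e" using gfH[OF v2(1)] by auto
          obtain z where z: "z \<noteq> v" "e = {v, z}" using card_2_obtain[of e v] H e by metis
          have "z \<in> e" using z by auto
          have "Inl e \<notin> C" using only by simp
          then have "(z, tag e z) \<in> U \<longleftrightarrow> (v, tag e v) \<in> U" using e z by (auto simp: CL)
          then have "z \<in> W \<longleftrightarrow> v \<notin> W" 
            using same[OF \<open>z \<in> e\<close> e(2)] same[OF e(3,2)] e(1) z(1) by simp
          then show "e \<in> bd H W" using e z by (auto simp: ecut_alt)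
        qed
        then show False using bridgeless[of W] by simp
      qed
      then obtain k where k: "k \<in> C" "k \<noteq> Inr v" using v by auto
      have "sum x {k, Inr v} \<le> sum x C"
        using k v finC by (intro sum_mono2) (auto simp: x_def split: sum.split)
      moreover have "x k \<ge> 1 / 3" by (auto simp: x_def split: sum.split)
      ultimately show ?thesis using k(2) by (simp add: C_def[symmetric]) (simp add: x_def)
    next
      case False
      \<comment> \<open>No new edge is cut, so the two copies of a vertex lie on the same side. Then
        \<open>card U\<close> is odd only if \<open>W\<close> has oddly many vertices of degree 3;
        hence the cut of \<open>W\<close> is odd and, not being 1, at least 3, with value 1/3 per
        edge.\<close>
      have sameR: "(u, True) \<in> U \<longleftrightarrow> u \<in> W" if "u \<in> D2" for u using False CR that by blast
      have same: "(u, tag e u) \<in> U \<longleftrightarrow> u \<in> W" for u e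
      proof (cases "tag e u")
        case True
        then have "u \<in> D2" by (simp add: tag_def)
        then show ?thesis using True sameR by simp
      qed (simp add: W_def)
      have C: "C = Inl ` bd H W"
      proof (intro set_eqI)
        fix k show "k \<in> C \<longleftrightarrow> k \<in> Inl ` bd H W"
          using False by (cases k) (auto simp: CL same ecut_alt)
      qed
      have finW: "finite W" using WD finD finite_subset by blast
      have "U = (\<lambda>u. (u, False)) ` W \<union> (\<lambda>u. (u, True)) ` (W \<inter> D2)"
      proof (intro set_eqI)
        fix p :: "'a \<times> bool"
        obtain u t where p: "p = (u, t)" by (cases p)
        show "p \<in> U \<longleftrightarrow> p \<in> (\<lambda>u. (u, False)) ` W \<union> (\<lambda>u. (u, True)) ` (W \<inter> D2)"
          using sameR[of u] U(1) p by (cases t) (auto simp: W_def V'_def)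
      qed
      moreover have "(\<lambda>u. (u, False)) ` W \<inter> (\<lambda>u. (u, True)) ` (W \<inter> D2) = {}" by auto
      ultimately have cU: "card U = card W + card (W \<inter> D2)"
        using finW by (simp add: card_Un_disjoint card_image inj_on_def)
      have W23: "W = (W \<inter> D2) \<union> (W \<inter> D3)" "(W \<inter> D2) \<inter> (W \<inter> D3) = {}"
        using WD finD(3) by auto
      have "card W = card (W \<inter> D2) + card (W \<inter> D3)"
        using card_Un_disjoint[OF _ _ W23(2)] finW W23(1) by simp
      then have odd3: "odd (card (W \<inter> D3))" using cU U(2) by presburger
      have "(\<Sum>v\<in>W. card {e \<in> H. v \<in> e})
          = (\<Sum>v\<in>W \<inter> D2. card {e \<in> H. v \<in> e}) + (\<Sum>v\<in>W \<inter> D3. card {e \<in> H. v \<in> e})"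
        using sum.union_disjoint[OF _ _ W23(2)] finW W23(1) by simp
      also have "\<dots> = 2 * card (W \<inter> D2) + 3 * card (W \<inter> D3)"
      proof -
        have "(\<Sum>v\<in>W \<inter> D2. card {e \<in> H. v \<in> e}) = (\<Sum>v\<in>W \<inter> D2. 2)"
          by (rule sum.cong) (auto simp: D2_def)
        moreover have "(\<Sum>v\<in>W \<inter> D3. card {e \<in> H. v \<in> e}) = (\<Sum>v\<in>W \<inter> D3. 3)"
          by (rule sum.cong) (auto simp: D3_def)
        ultimately show ?thesis by simp
      qed
      finally have "odd (card (bd H W))"
        using even_degree_sum_iff_even_cut[of H W] finH H finW odd3 by simp
      then have "card (bd H W) \<ge> 3"
        using bridgeless[of W] by presburger
      moreover have "sum x C = card (bd H W) / 3"
        unfolding C by (simp add: sum.reindex x_def)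
      ultimately show ?thesis unfolding C_def[symmetric] by simp
    qed
  qed
  \<comment> \<open>New edges weigh nothing, so the matching in the split graph weighs as much as
    its trace \<open>F\<close> on \<open>H\<close>.\<close>
  define w' :: "'a set + 'a \<Rightarrow> real" where "w' = case_sum w (\<lambda>_. 0)"
  have "fractional_pm V' E' ends x"
    unfolding fractional_pm_def using fin' ends' sum1 sumU by blast
  then obtain M where M: "perfect_matching V' E' ends M"
      "sum w' M \<le> (\<Sum>k\<in>E'. w' k * x k)"
    using edmonds_perfect_matching[unfolded dominates_pm_def, rule_format] by blast
  have ME: "M \<subseteq> E'" and M1: "\<And>p. p \<in> V' \<Longrightarrow> card (ecut ends M {p}) = 1"
    using M(1) by (auto simp: perfect_matching_def)
  define F where "F = {e. Inl e \<in> M}"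
  have FH: "F \<subseteq> H" using ME by (auto simp: F_def E'_def)
  have "card {e \<in> F. v \<in> e} = 1" if "v \<in> D3" for v
  proof -
    have "card (ecut ends M {(v, False)}) = 1" using that by (intro M1) (auto simp: V'_def)
    then show ?thesis unfolding cut3[OF ME that] by (simp add: card_image F_def)
  qed
  moreover have "even (card {e \<in> F. v \<in> e})" if v: "v \<in> D2" for v
  proof -
    have c: "card (M \<inter> {Inl (g v), Inr v}) = 1" "card (M \<inter> {Inl (f v), Inr v}) = 1"
      using M1[of "(v, True)"] M1[of "(v, False)"] v by (auto simp: V'_def cut2[OF ME v])
    have "{e \<in> F. v \<in> e} = F \<inter> {e \<in> H. v \<in> e}" using FH by blast
    then have Fv: "{e \<in> F. v \<in> e} = F \<inter> {g v, f v}" by (simp only: gf(1)[OF v])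
    show ?thesis
    proof (cases "Inr v \<in> M")
      case True
      have "Inl e \<notin> M" if "card (M \<inter> {Inl e, Inr v}) = 1" for e
      proof
        assume "Inl e \<in> M"
        then show False using that True by simp
      qed
      then have "Inl (g v) \<notin> M" "Inl (f v) \<notin> M" using c by blast+
      then have "F \<inter> {g v, f v} = {}" by (simp add: F_def)
      then show ?thesis by (simp add: Fv)
    next
      case False
      have "Inl e \<in> M" if "card (M \<inter> {Inl e, Inr v}) = 1" for e
        using that False by (cases "Inl e \<in> M") simp_all
      then have "Inl (g v) \<in> M" "Inl (f v) \<in> M" using c by blast+
      then have "F \<inter> {g v, f v} = {g v, f v}" by (simp add: F_def)
      then show ?thesis using gf(2)[OF v] by (simp add: Fv)
    qed
  qed
  moreover have "sum w F \<le> sum w H / 3"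
  proof -
    have "sum w F = sum w' (Inl ` F)" by (simp add: sum.reindex w'_def)
    also have "\<dots> = sum w' M"
      using ME fin' by (intro sum.mono_neutral_left) (auto simp: F_def E'_def w'_def finite_subset)
    also have "\<dots> \<le> (\<Sum>k\<in>E'. w' k * x k)" by (rule M(2))
    also have "\<dots> = (\<Sum>k\<in>Inl ` H. w' k * x k)"
      using fin' by (intro sum.mono_neutral_right) (auto simp: E'_def w'_def)
    also have "\<dots> = sum w H / 3" by (simp add: sum.reindex x_def w'_def sum_divide_distrib)
    finally show ?thesis .
  qed
  ultimately show ?thesis using FH by (intro exI[of _ F]) (auto simp: D2_def D3_def)
qed

subsection \<open>Bridges\<close>

lemma conn_mono:
  assumes "conn S F" "F \<subseteq> G"
  shows "conn S G"
proof -
  have "bd F W \<subseteq> bd G W" for W using assms(2) by (auto simp: ecut_def)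
  then show ?thesis using assms(1) unfolding conn_def by (metis subset_empty)
qed

lemma bd_singleton:
  assumes "\<forall>e\<in>F. card e = 2"
  shows "bd F {v} = {e \<in> F. v \<in> e}"
proof -
  have "e \<in> bd F {v} \<longleftrightarrow> e \<in> F \<and> v \<in> e" if "e \<in> F" for e
    using assms that by (intro ecut_singleton) blast
  then show ?thesis using ecut_subset[of "\<lambda>e. e" F "{v}"] by blast
qed

text \<open>Serves the case in which all edges are bridges: the tree then has to be all of
  \<open>E\<close>, which gives \<open>h + 1 = n\<close>.\<close>

lemma spanning_tree_exists:
  assumes "finite V" "V \<noteq> {}" "\<forall>e\<in>E. card e = 2 \<and> e \<subseteq> V" "conn V E"
  shows "\<exists>T\<subseteq>E. conn V T \<and> card T + 1 = card V \<and> finite T"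
proof -
  have "\<exists>S T. S \<subseteq> V \<and> T \<subseteq> induced E S \<and> finite T \<and> conn S T \<and> card S = Suc k \<and> card T = k"
    if "k < card V" for k
    using that
  proof (induction k)
    case 0
    obtain v where "v \<in> V" using assms(2) by blast
    moreover have "conn {v} {}" by (auto simp: conn_def)
    ultimately show ?case by (intro exI[of _ "{v}"] exI[of _ "{}"]) auto
  next
    case (Suc k)
    then obtain S T where ST: "S \<subseteq> V" "T \<subseteq> induced E S" "finite T" "conn S T" "card S = Suc k" "card T = k"
      by auto
    have "S \<noteq> V" "S \<noteq> {}" using ST(5) Suc.prems by auto
    then have "bd E S \<noteq> {}" using assms(4) ST(1) by (auto simp: conn_def)
    then obtain e where e: "e \<in> E" "e \<inter> S \<noteq> {}" "\<not> e \<subseteq> S" by (auto simp: ecut_def)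
    then obtain a where a: "a \<in> e" "a \<in> S" by blast
    have "card e = 2" using assms(3) e(1) by blast
    then obtain b where b: "b \<noteq> a" "e = {a, b}" using card_2_obtain a(1) by metis
    have bS: "b \<notin> S" "b \<in> V" using e a b assms(3) by auto
    have "e \<notin> T" using ST(2) e(3) by blast
    have indS: "induced (insert e T) S = T" using ST(2) e(3) by auto
    have "conn {b} (induced (insert e T) {b})" by (auto simp: conn_def)
    then have "conn (S \<union> {b}) (induced (insert e T) (S \<union> {b}))"
      using conn_join[of S "insert e T" "{b}" e] ST(4) a b indS by simp
    then have "conn (S \<union> {b}) (insert e T)" by (rule conn_mono) blast
    then have "conn (insert b S) (insert e T)" by simp
    moreover have "card (insert b S) = Suc (Suc k)" "card (insert e T) = Suc k"
      using bS ST \<open>e \<notin> T\<close> finite_subset[OF ST(1) assms(1)] by auto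
    moreover have "insert e T \<subseteq> induced E (insert b S)" using ST(2) e(1) a b by auto
    moreover have "insert b S \<subseteq> V" using ST(1) bS by auto
    ultimately show ?case using ST(3) by (intro exI[of _ "insert b S"] exI[of _ "insert e T"]) auto
  qed
  moreover have "card V > 0" using assms by (simp add: card_gt_0_iff)
  ultimately obtain S T where "S \<subseteq> V" "T \<subseteq> induced E S" "finite T" "conn S T"
      "card S = card V" "card T = card V - 1"
    by (metis Suc_diff_1 lessI)
  moreover then have "S = V" using assms(1) by (intro card_subset_eq) auto
  ultimately show ?thesis using \<open>card V > 0\<close> by (intro exI[of _ T]) auto
qed

lemma simple_graph_edges:
  assumes "simple_graph V E"
  shows "finite V" "finite E" "\<forall>e\<in>E. card e = 2 \<and> e \<subseteq> V"
proof -
  show V: "finite V" using assms by (simp add: simple_graph_def)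
  show E: "\<forall>e\<in>E. card e = 2 \<and> e \<subseteq> V"
  proof
    fix e assume "e \<in> E"
    then obtain u v where "u \<in> V" "v \<in> V" "u \<noteq> v" "e = {u, v}"
      using assms unfolding simple_graph_def by blast
    then show "card e = 2 \<and> e \<subseteq> V" by simp
  qed
  have "E \<subseteq> Pow V" using E by blast
  then show "finite E" using V by (meson finite_Pow_iff finite_subset)
qed

lemma connected_simple_graph:
  assumes "simple_graph V E" "connected_graph V E"
  shows "V \<noteq> {}" "conn V E"
proof -
  have "\<forall>e\<in>E. e \<subseteq> V \<and> card e = 2" using simple_graph_edges(3)[OF assms(1)] by blast
  from connected_graph_iff_conn[OF this] show "V \<noteq> {}" "conn V E" using assms(2) by simp_all
qed

lemma bridge_iff_not_conn:
  assumes "simple_graph V E" "connected_graph V E" "e \<in> E"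
  shows "e \<in> bridges V E \<longleftrightarrow> \<not> conn V (E - {e})"
proof -
  have "\<forall>e'\<in>E - {e}. e' \<subseteq> V \<and> card e' = 2" using simple_graph_edges(3)[OF assms(1)] by blast
  moreover have "V \<noteq> {}" using assms(2) by (simp add: connected_graph_def)
  ultimately have "connected_graph V (E - {e}) \<longleftrightarrow> conn V (E - {e})"
    using connected_graph_iff_conn[of "E - {e}" V] by blast
  then show ?thesis using assms(3) by (simp add: bridges_def)
qed

text \<open>Turns bridges into singleton cuts, the form in which parity and symmetric differences
  apply. The set \<open>W\<close> is arbitrary and may reach outside \<open>V\<close>, so it is
  intersected with \<open>V\<close> where \<open>conn\<close> is used.\<close>

lemma bridge_iff_cut:
  assumes g: "simple_graph V E" "connected_graph V E" and "e \<in> E"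
  shows "e \<in> bridges V E \<longleftrightarrow> (\<exists>W. bd E W = {e})"
proof -
  note E = simple_graph_edges(3)[OF g(1)]
  note con = connected_simple_graph(2)[OF g]
  show ?thesis
    unfolding bridge_iff_not_conn[OF assms]
  proof
    assume "\<not> conn V (E - {e})"
    then obtain W where W: "W \<noteq> {}" "W \<subset> V" "bd (E - {e}) W = {}" unfolding conn_def by blast
    then have "bd E W \<noteq> {}" using con by (simp add: conn_def)
    moreover have "f = e" if "f \<in> bd E W" for f
    proof (rule ccontr)
      assume "f \<noteq> e"
      then have "f \<in> bd (E - {e}) W" using that by (simp add: ecut_def)
      then show False using W(3) by simp
    qed
    ultimately have "bd E W = {e}" by (metis subsetI subset_singletonD singletonI)
    then show "\<exists>W. bd E W = {e}" by blast
  next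
    assume "\<exists>W. bd E W = {e}"
    then obtain W where W: "bd E W = {e}" by blast
    then have "e \<in> bd E W" by simp
    then have e: "e \<inter> W \<noteq> {}" "\<not> e \<subseteq> W" by (simp_all add: ecut_def)
    have eV: "e \<subseteq> V" using E assms(3) by blast
    then have W': "W \<inter> V \<noteq> {}" "W \<inter> V \<subset> V" using e by auto
    have "f \<notin> bd (E - {e}) (W \<inter> V)" for f
    proof
      assume f: "f \<in> bd (E - {e}) (W \<inter> V)"
      then have fE: "f \<in> E" "f \<noteq> e" by (simp_all add: ecut_def)
      then have "f \<subseteq> V" using E by blast
      moreover have "f \<inter> (W \<inter> V) \<noteq> {}" "\<not> f \<subseteq> W \<inter> V" using f by (simp_all add: ecut_def)
      ultimately have "f \<in> bd E W" using fE(1) by (auto simp: ecut_def)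
      then show False using W fE(2) by simp
    qed
    then have "bd (E - {e}) (W \<inter> V) = {}" by auto
    then show "\<not> conn V (E - {e})" using W' by (metis conn_def)
  qed
qed

text \<open>Cuts add modulo 2 under symmetric difference of the vertex sets.\<close>

lemma bd_sym_diff:
  assumes "e \<in> E" "card e = 2"
  shows "e \<in> bd E ((W - W') \<union> (W' - W)) \<longleftrightarrow> \<not> (e \<in> bd E W \<longleftrightarrow> e \<in> bd E W')"
proof -
  obtain a b where ab: "e = {a, b}" using assms(2) unfolding card_2_iff by blast
  show ?thesis using assms(1)
    by (cases "a \<in> W"; cases "b \<in> W"; cases "a \<in> W'"; cases "b \<in> W'") (auto simp: ecut_def ab)
qed

text \<open>Bridges can be removed from a cut one by one, by adding the cuts that witness them.\<close>

lemma bridgeless_without_bridges: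
  assumes g: "simple_graph V E" "connected_graph V E"
  shows "card (bd (E - bridges V E) W) \<noteq> 1"
proof (induction "card (bd E W \<inter> bridges V E)" arbitrary: W rule: less_induct)
  case less
  note fin = simple_graph_edges(2)[OF g(1)] and E = simple_graph_edges(3)[OF g(1)]
  define B where "B = bridges V E"
  show ?case
  proof (cases "bd E W \<inter> B = {}")
    case True
    show ?thesis
    proof
      assume "card (bd (E - bridges V E) W) = 1"
      then obtain f where f: "bd (E - B) W = {f}" by (auto simp: card_1_singleton_iff B_def)
      moreover have "bd E W = bd (E - B) W" using True by (auto simp: ecut_def)
      ultimately have "bd E W = {f}" by simp
      moreover have "f \<in> E - B" using f by (auto simp: ecut_def)
      ultimately show False using bridge_iff_cut[OF g, of f] by (auto simp: B_def)
    qed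
  next
    case False
    then obtain b where b: "b \<in> bd E W" "b \<in> B" by blast
    then have bE: "b \<in> E" by (simp add: ecut_def)
    then obtain W' where W': "bd E W' = {b}" using bridge_iff_cut[OF g] b(2) by (auto simp: B_def)
    define U where "U = (W - W') \<union> (W' - W)"
    have U: "e \<in> bd E U \<longleftrightarrow> e \<in> bd E W \<and> e \<noteq> b" for e
    proof (cases "e \<in> E")
      case True
      then have "e \<in> bd E U \<longleftrightarrow> \<not> (e \<in> bd E W \<longleftrightarrow> e \<in> bd E W')"
        unfolding U_def using E by (intro bd_sym_diff) auto
      then show ?thesis using W' b(1) by auto
    qed (auto simp: ecut_def)
    have eq: "bd (E - B) A = bd E A - B" for A by (auto simp: ecut_def)
    have "bd E U = bd E W - {b}" using U by blast
    then have "bd E U \<inter> B = (bd E W \<inter> B) - {b}" "bd (E - B) U = bd (E - B) W"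
      using b(2) by (auto simp: eq)
    moreover have "finite (bd E W \<inter> B)" using fin by (simp add: ecut_def)
    ultimately have "card (bd E U \<inter> B) < card (bd E W \<inter> B)"
      using b by (simp only: card_Diff1_less IntI)
    then have "card (bd (E - B) U) \<noteq> 1" using less[of U] by (simp add: B_def)
    then show ?thesis using \<open>bd (E - B) U = bd (E - B) W\<close> by (simp add: B_def)
  qed
qed

section \<open>Assembling the tour\<close>

lemma mdeg_mset_set: "finite A \<Longrightarrow> mdeg (mset_set A) v = card {e \<in> A. v \<in> e}"
  by (simp add: mdeg_def)

lemma mdeg_add: "mdeg (M + N) v = mdeg M v + mdeg N v"
  by (simp add: mdeg_def)

theorem theorem6:
  fixes V :: "'a set" and E :: "'a set set" and n h s :: nat
  assumes "simple_graph V E"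
    and "connected_graph V E"
    and "subcubic V E"
    and "n = card V"
    and "h = card (bridges V E)"
    and "s = card {v \<in> V. card {e \<in> bridges V E. v \<in> e} > 1}"
  shows "\<exists>xs L. graph_tsp_tour V E xs L \<and>
           real L \<le> 4 / 3 * (real n + real h) - 2 / 3 * (real s + 1)"
proof -
  note g = assms(1,2)
  note finV = simple_graph_edges(1)[OF g(1)] and finE = simple_graph_edges(2)[OF g(1)]
    and E2 = simple_graph_edges(3)[OF g(1)]
  note Vne = connected_simple_graph(1)[OF g] and con = connected_simple_graph(2)[OF g]
  have deg3: "card {e \<in> E. v \<in> e} \<le> 3" for v
  proof (cases "v \<in> V")
    case True
    then show ?thesis using assms(3) by (simp add: subcubic_def degree_def)
  next
    case False
    then have "{e \<in> E. v \<in> e} = {}" using E2 by blast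
    then show ?thesis by (simp only: card.empty le0)
  qed
  define B where "B = bridges V E"
  have BE: "B \<subseteq> E" by (auto simp: B_def bridges_def)
  define H where "H = E - B"
  define S where "S = {v \<in> V. card {e \<in> B. v \<in> e} > 1}"
  have finB: "finite B" "finite H" and finS: "finite S"
    using finE BE finV finite_subset by (auto simp: H_def S_def)
  have h: "h = card B" and s: "s = card S" using assms(5,6) by (simp_all add: B_def S_def)
  have tour: "\<exists>xs L. graph_tsp_tour V E xs L \<and>
           real L \<le> 4 / 3 * (real n + real h) - 2 / 3 * (real s + 1)"
    if N: "\<forall>e \<in># N. e \<in> E" "\<forall>v. even (mdeg N v)" "conn V (set_mset N)"
      "real (size N) \<le> 4 / 3 * (real n + real h) - 2 / 3 * (real s + 1)" for N
  proof -
    obtain xs L where "graph_tsp_tour V E xs L" "L \<le> size N"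
      using tour_of_even_multigraph[OF g(2) N(1) E2 N(2,3)] by blast
    moreover then have "real L \<le> 4 / 3 * (real n + real h) - 2 / 3 * (real s + 1)"
      using N(4) by linarith
    ultimately show ?thesis by blast
  qed
  show ?thesis
  proof (cases "H = {}")
    case True
    then have EB: "E = B" using BE by (auto simp: H_def)
    obtain T where T: "T \<subseteq> E" "conn V T" "card T + 1 = card V"
      using spanning_tree_exists[OF finV Vne E2 con] by blast
    have "E \<subseteq> T"
    proof
      fix e assume e: "e \<in> E"
      show "e \<in> T"
      proof (rule ccontr)
        assume "e \<notin> T"
        then have "conn V (E - {e})" using T by (intro conn_mono[OF T(2)]) blast
        moreover have "e \<in> bridges V E" using e EB B_def by blast
        ultimately show False using bridge_iff_not_conn[OF g e] by blast
      qed
    qed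
    then have "T = B" using T(1) EB by blast
    then have hn: "h + 1 = n" using T(3) h assms(4) by simp
    \<comment> \<open>The doubled tree has \<open>2 * (n - 1)\<close> edges, and for
      \<open>h = n - 1\<close> the claimed bound exceeds this by
      \<open>2/3 * (n - s)\<close>.\<close>
    have sn: "s \<le> n" unfolding s assms(4) using finV by (intro card_mono) (auto simp: S_def)
    show ?thesis
    proof (rule tour[of "mset_set E + mset_set E"])
      show "\<forall>e\<in>#mset_set E + mset_set E. e \<in> E" using finE by simp
      show "\<forall>v. even (mdeg (mset_set E + mset_set E) v)" by (simp add: mdeg_add)
      show "conn V (set_mset (mset_set E + mset_set E))" using con finE by simp
      show "real (size (mset_set E + mset_set E)) \<le> 4 / 3 * (real n + real h) - 2 / 3 * (real s + 1)"
      proof -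
        have size: "real (size (mset_set E + mset_set E)) = 2 * real h" using h EB by simp
        have "real h + 1 = real n" "real s \<le> real n" using hn sn by simp_all
        then show ?thesis unfolding size by (simp add: field_simps)
      qed
    qed
  next
    case False
    then obtain e0 where e0: "e0 \<in> E" "e0 \<notin> B" by (auto simp: H_def)
    then obtain r where r: "r \<in> e0" using E2 by fastforce
    have rV: "r \<in> V" using E2 e0 r by blast
    \<comment> \<open>Leaving out \<open>e0\<close> lowers the degree of \<open>r\<close> to at most
      2, as the recursion demands. Connectivity is then obtained without \<open>e0\<close>, so
      \<open>e0\<close> may be deleted at will; this is the summand 1 in \<open>card R\<close> and
      the final \<open>- 2/3\<close>.\<close>
    define E0 where "E0 = E - {e0}"
    have E0: "finite E0" "E0 \<subseteq> E" "e0 \<notin> E0" using finE by (auto simp: E0_def)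
    have con0: "conn V E0" using bridge_iff_not_conn[OF g e0(1)] e0(2) by (simp add: E0_def B_def)
    have degr: "card {e \<in> E0. r \<in> e} \<le> 2"
    proof -
      have "{e \<in> E. r \<in> e} = insert e0 {e \<in> E0. r \<in> e}" using e0(1) r by (auto simp: E0_def)
      then show ?thesis using deg3[of r] E0 by simp
    qed
    have ind: "induced (E0 - D) V = E0 - D" for D using E2 E0(2) by blast
    have ind0: "induced E0 V = E0" using ind[of "{}"] by simp
    have "\<exists>Q p par. removable_pairing E0 V r Q p par"
    proof (rule removable_pairing_exists)
      show "card {e \<in> E0. v \<in> e} \<le> 3" for v
        using card_mono[of "{e \<in> E. v \<in> e}" "{e \<in> E0. v \<in> e}"] E0(2) finE deg3[of v] by force
    qed (use E0 E2 finV rV degr con0 ind0 in auto)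
    then obtain Q p par where Q: "removable_pairing E0 V r Q p par" by blast
    note Q = Q[unfolded removable_pairing_def ind ind0]
    have QV: "Q \<subseteq> V" using Q by blast
    have p: "p v \<subseteq> {e \<in> E0. v \<in> e}" "card (p v) = 2" if "v \<in> Q" for v using Q that by blast+
    have pdisj: "p v \<inter> p u = {}" if "v \<in> Q" "u \<in> Q" "v \<noteq> u" for v u using Q that by blast
    have cE0: "card E0 + 1 = card V + card Q" using Q by blast
    have parinj: "inj_on par (V - {r})" using Q by blast
    have par: "par v \<in> E0" "v \<in> par v" "v \<in> Q \<Longrightarrow> par v \<notin> p v" if "v \<in> V - {r}" for v
      using Q that by blast+
    have Qcon: "conn V (E0 - D)" if "\<forall>v\<in>Q. \<not> p v \<subseteq> D" "D \<subseteq> \<Union> (p ` Q)" for D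
      using Q that by blast
    \<comment> \<open>One edge alone never exhausts a pair, so its deletion leaves the graph
      connected and it is no bridge.\<close>
    have pH: "p v \<subseteq> H" if v: "v \<in> Q" for v
    proof
      fix e assume e: "e \<in> p v"
      have "\<not> p u \<subseteq> {e}" if "u \<in> Q" for u using card_mono[of "{e}" "p u"] p(2)[OF that] by auto
      then have "conn V (E0 - {e})" using e v by (intro Qcon) auto
      then have "conn V (E - {e})" by (rule conn_mono) (auto simp: E0_def)
      moreover have "e \<in> E" using p(1)[OF v] e E0(2) by blast
      ultimately show "e \<in> H" using bridge_iff_not_conn[OF g] by (simp add: H_def B_def)
    qed
    define d where "d v = card {e \<in> H. v \<in> e}" for v
    have finHv: "finite {e \<in> H. v \<in> e}" for v using finB by simp
    have bl: "card (bd H W) \<noteq> 1" for W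
      unfolding H_def B_def by (rule bridgeless_without_bridges[OF g])
    have dB: "d v + card {e \<in> B. v \<in> e} \<le> 3" for v
    proof -
      have "{e \<in> E. v \<in> e} = {e \<in> H. v \<in> e} \<union> {e \<in> B. v \<in> e}" using BE by (auto simp: H_def)
      moreover have "{e \<in> H. v \<in> e} \<inter> {e \<in> B. v \<in> e} = {}" by (auto simp: H_def)
      ultimately show ?thesis using deg3[of v] finB by (simp add: d_def card_Un_disjoint)
    qed
    have d: "d v \<in> {0, 2, 3}" for v
    proof -
      have "\<forall>e\<in>H. card e = 2" using E2 by (simp add: H_def)
      then have "d v \<noteq> 1" using bl[of "{v}"] by (simp add: d_def bd_singleton)
      moreover have "d v \<le> 3" using dB[of v] by simp
      ultimately have "d v = 0 \<or> d v = 2 \<or> d v = 3" by linarith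
      then show ?thesis by simp
    qed
    have d2: "d v \<ge> 2" if "v \<in> Q" for v
    proof -
      have "p v \<subseteq> {e \<in> H. v \<in> e}" using p(1)[OF that] pH[OF that] by blast
      then have "card (p v) \<le> d v" unfolding d_def by (rule card_mono[OF finHv])
      then show ?thesis using p(2)[OF that] by simp
    qed
    define Q2 where "Q2 = {v \<in> Q. d v = 2}"
    define Q3 where "Q3 = {v \<in> Q. d v = 3}"
    have finQ: "finite Q" using QV finV finite_subset by blast
    have "d v = 2 \<or> d v = 3" if "v \<in> Q" for v using d[of v] d2[OF that] by auto
    then have Q23: "Q = Q2 \<union> Q3" "Q2 \<inter> Q3 = {}" "finite Q2" "finite Q3"
      using finQ by (auto simp: Q2_def Q3_def)
    have e0H: "e0 \<in> H" using e0 by (simp add: H_def)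
    \<comment> \<open>At a vertex of \<open>Q2\<close> the pair consists of all non-bridges, so the
      parent edge, which is outside the pair, is a bridge; the root is excluded since
      \<open>e0\<close> is a non-bridge at \<open>r\<close> outside all pairs. At a vertex of
      \<open>S\<close> two bridges leave at most one non-bridge, hence none.\<close>
    have parB: "par v \<in> B" "v \<noteq> r" if v: "v \<in> Q2 \<union> S" for v
    proof -
      have "par v \<in> B \<and> v \<noteq> r"
      proof (cases "v \<in> Q2")
        case True
        then have vQ: "v \<in> Q" and dv: "d v = 2" by (auto simp: Q2_def)
        have *: "False" if "e \<in> H" "v \<in> e" "e \<notin> p v" for e
        proof -
          have "insert e (p v) \<subseteq> {e \<in> H. v \<in> e}" using p(1)[OF vQ] pH[OF vQ] that by blast
          then have "card (insert e (p v)) \<le> d v" unfolding d_def using finHv by (intro card_mono)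
          moreover have "finite (p v)" using p(2)[OF vQ] by (simp add: card_ge_0_finite)
          ultimately show False using that(3) p(2)[OF vQ] dv by simp
        qed
        have "v \<noteq> r" using *[OF e0H] r p(1)[OF vQ] E0(3) by blast
        moreover have "v \<in> V" using vQ QV by blast
        ultimately show ?thesis using par[of v] *[of "par v"] vQ E0(2) by (auto simp: H_def)
      next
        case False
        then have "v \<in> V" "card {e \<in> B. v \<in> e} > 1" using v by (auto simp: S_def)
        then have "d v = 0" using dB[of v] d[of v] by auto
        then have *: "{e \<in> H. v \<in> e} = {}" using finHv by (simp add: d_def)
        then have "v \<noteq> r" using e0H r by blast
        then show ?thesis using par[of v] * \<open>v \<in> V\<close> E0(2) by (auto simp: H_def)
      qed
      then show "par v \<in> B" "v \<noteq> r" by blast+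
    qed
    have count: "card Q2 + s \<le> h"
    proof -
      have "d v \<noteq> 2" if "v \<in> S" for v using dB[of v] d[of v] that by (auto simp: S_def)
      then have "Q2 \<inter> S = {}" by (auto simp: Q2_def)
      then have "card Q2 + s = card (Q2 \<union> S)" using Q23 finS by (simp add: s card_Un_disjoint)
      also have "\<dots> \<le> card B"
      proof (rule card_inj_on_le)
        have "Q2 \<union> S \<subseteq> V - {r}" using parB(2) QV Q23(1) by (auto simp: S_def)
        then show "inj_on par (Q2 \<union> S)" using parinj by (rule inj_on_subset[rotated])
        show "par ` (Q2 \<union> S) \<subseteq> B" using parB(1) by blast
      qed (rule finB)
      finally show ?thesis by (simp add: h)
    qed
    define c where "c v = (SOME e. e \<in> p v)" for v
    have c: "c v \<in> p v" if "v \<in> Q" for v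
    proof -
      have "p v \<noteq> {}" using p(2)[OF that] by auto
      then show ?thesis unfolding c_def by (simp add: some_in_eq)
    qed
    \<comment> \<open>At a vertex of \<open>Q2\<close> the set \<open>F\<close> may contain both
      edges of the pair, so only \<open>c v\<close> is made removable.\<close>
    define q where "q v = (if v \<in> Q3 then p v else {c v})" for v
    have qp: "q v \<subseteq> p v" if "v \<in> Q" for v using c[OF that] by (simp add: q_def)
    have pfin: "finite (p v)" if "v \<in> Q" for v using p(2)[OF that] by (simp add: card_ge_0_finite)
    define R where "R = insert e0 (\<Union> (q ` Q))"
    have RH: "R \<subseteq> H" using qp pH e0H by (auto simp: R_def)
    have cR: "card R = 1 + 2 * card Q3 + card Q2"
    proof -
      have "e0 \<notin> \<Union> (q ` Q)" using qp p(1) E0(3) by blast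
      moreover have "finite (\<Union> (q ` Q))" using finQ qp pfin finite_subset by blast
      moreover have "card (\<Union> (q ` Q)) = (\<Sum>v\<in>Q. card (q v))"
      proof (rule card_UN_disjoint[OF finQ])
        show "\<forall>v\<in>Q. finite (q v)" using qp pfin finite_subset by blast
        show "\<forall>v\<in>Q. \<forall>u\<in>Q. v \<noteq> u \<longrightarrow> q v \<inter> q u = {}" using qp pdisj by blast
      qed
      moreover have "(\<Sum>v\<in>Q. card (q v)) = (\<Sum>v\<in>Q2. card (q v)) + (\<Sum>v\<in>Q3. card (q v))"
        unfolding Q23(1) using Q23 by (intro sum.union_disjoint)
      moreover have "(\<Sum>v\<in>Q2. card (q v)) = (\<Sum>v\<in>Q2. 1)"
        using Q23(2) by (intro sum.cong) (auto simp: q_def)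
      moreover have "(\<Sum>v\<in>Q3. card (q v)) = (\<Sum>v\<in>Q3. 2)"
        using Q23(1) p(2) by (intro sum.cong) (auto simp: q_def)
      ultimately show ?thesis by (simp add: R_def)
    qed
    \<comment> \<open>The weight is the change in length: an edge of \<open>F\<close> has
      multiplicity 1 at first and ends with 0 if removable, with 2 otherwise.\<close>
    define w :: "'a set \<Rightarrow> real" where "w e = (if e \<in> R then - 1 else 1)" for e
    have sumw: "sum w A = real (card A) - 2 * real (card (A \<inter> R))" if "finite A" for A
    proof -
      have "sum w A = (\<Sum>e\<in>A. 1 - 2 * (if e \<in> R then 1 else 0))"
        by (intro sum.cong) (auto simp: w_def)
      also have "\<dots> = real (card A) - 2 * (\<Sum>e\<in>A. if e \<in> R then 1 else 0)"
        by (simp add: sum_subtractf sum_distrib_left)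
      finally show ?thesis using that by (simp add: sum.If_cases)
    qed
    obtain F where F: "F \<subseteq> H" "\<forall>v\<in>V. d v = 3 \<longrightarrow> card {e \<in> F. v \<in> e} = 1"
        "\<forall>v\<in>V. d v = 2 \<longrightarrow> even (card {e \<in> F. v \<in> e})" "sum w F \<le> sum w H / 3"
      using light_parity_factor[of V H w] finV E2 d bl unfolding d_def H_def by blast
    have finF: "finite F" using F(1) finB finite_subset by blast
    define D where "D = F \<inter> R - {e0}"
    have "conn V (E0 - D)"
    proof (rule Qcon)
      show "D \<subseteq> \<Union> (p ` Q)" using qp by (auto simp: D_def R_def)
      show "\<forall>v\<in>Q. \<not> p v \<subseteq> D"
      proof (intro ballI notI)
        fix v assume v: "v \<in> Q" "p v \<subseteq> D"
        show False
        proof (cases "v \<in> Q3")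
          case True
          have "p v \<subseteq> {e \<in> F. v \<in> e}" using v p(1) by (auto simp: D_def)
          then have "card (p v) \<le> card {e \<in> F. v \<in> e}" using finF by (intro card_mono) auto
          moreover have "card {e \<in> F. v \<in> e} = 1" using F(2) True QV by (auto simp: Q3_def)
          ultimately show False using p(2)[OF v(1)] by simp
        next
          case False
          \<comment> \<open>Pairs are disjoint, so an edge of \<open>p v\<close> can be removable
            only on account of \<open>v\<close> itself.\<close>
          have "p v \<subseteq> {c v}"
          proof
            fix e assume e: "e \<in> p v"
            then have "e \<in> R" "e \<noteq> e0" using v(2) by (auto simp: D_def)
            then obtain u where u: "u \<in> Q" "e \<in> q u" by (auto simp: R_def)
            then have "u = v" using pdisj[OF u(1) v(1)] qp[OF u(1)] e by blast
            then show "e \<in> {c v}" using u(2) False by (simp add: q_def)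
          qed
          then show False using card_mono[of "{c v}" "p v"] p(2)[OF v(1)] by simp
        qed
      qed
    qed
    \<comment> \<open>\<open>Z\<close> collects the edges used twice; \<open>H - F\<close> is used
      once and \<open>F \<inter> R\<close> not at all. Only \<open>H - F\<close> matters for the
      parities.\<close>
    define Z where "Z = B \<union> (F - R)"
    have finZ: "finite Z" using finB finF by (simp add: Z_def)
    show ?thesis
    proof (rule tour[of "mset_set (H - F) + (mset_set Z + mset_set Z)"])
      have setN: "set_mset (mset_set (H - F) + (mset_set Z + mset_set Z)) = (H - F) \<union> Z"
        using finB finZ by simp
      show "\<forall>e\<in>#mset_set (H - F) + (mset_set Z + mset_set Z). e \<in> E"
        unfolding setN using F(1) BE by (auto simp: H_def Z_def)
      show "conn V (set_mset (mset_set (H - F) + (mset_set Z + mset_set Z)))"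
        unfolding setN
      proof (rule conn_mono[OF \<open>conn V (E0 - D)\<close>])
        show "E0 - D \<subseteq> H - F \<union> Z" by (auto simp: E0_def D_def H_def Z_def)
      qed
      show "\<forall>v. even (mdeg (mset_set (H - F) + (mset_set Z + mset_set Z)) v)"
      proof
        fix v
        have eq: "{e \<in> H - F. v \<in> e} = {e \<in> H. v \<in> e} - {e \<in> F. v \<in> e}" by blast
        have sub: "{e \<in> F. v \<in> e} \<subseteq> {e \<in> H. v \<in> e}" using F(1) by blast
        then have le: "card {e \<in> F. v \<in> e} \<le> d v" unfolding d_def using finHv by (intro card_mono)
        have "card {e \<in> H - F. v \<in> e} = d v - card {e \<in> F. v \<in> e}"
          unfolding eq d_def using sub finF by (intro card_Diff_subset) auto
        moreover have "even (d v - card {e \<in> F. v \<in> e})"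
        proof (cases "d v = 0")
          case False
          then have "{e \<in> H. v \<in> e} \<noteq> {}" unfolding d_def by fastforce
          then have "v \<in> V" using E2 by (auto simp: H_def)
          then show ?thesis using F(2,3) d[of v] le by auto
        qed simp
        ultimately show "even (mdeg (mset_set (H - F) + (mset_set Z + mset_set Z)) v)"
          using finB finZ by (simp add: mdeg_add mdeg_mset_set)
      qed
      have cZ: "card Z = card B + card (F - R)"
        unfolding Z_def using finB finF F(1) by (intro card_Un_disjoint) (auto simp: H_def)
      have cFR: "card (F - R) + card (F \<inter> R) = card F"
      proof -
        have "(F - R) \<inter> (F \<inter> R) = {}" by blast
        then show ?thesis
          using card_Un_disjoint[of "F - R" "F \<inter> R"] finF by (simp add: Un_Diff_Int)
      qed
      have cHF: "card (H - F) + card F = card H"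
        using card_Diff_subset[OF finF F(1)] card_mono[OF finB(2) F(1)] by simp
      have "size (mset_set (H - F) + (mset_set Z + mset_set Z)) = card (H - F) + 2 * card Z"
        by simp
      then have sz: "real (size (mset_set (H - F) + (mset_set Z + mset_set Z)))
          = real (card H) + sum w F + 2 * real h"
        using sumw[OF finF] cZ cFR cHF h by linarith
      have "H \<inter> R = R" using RH by blast
      then have wH: "sum w H = real (card H) - 2 * real (card R)"
        using sumw[OF finB(2)] by simp
      have "card E = card E0 + 1"
        unfolding E0_def using card.remove[OF finE e0(1)] by simp
      moreover have "card H + card B = card E"
        unfolding H_def using card_Diff_subset[OF finB(1) BE] card_mono[OF finE BE] by simp
      ultimately have cH: "real (card H) = real n + real (card Q) - real h"
        using cE0 assms(4) h by linarith
      have cQ: "real (card Q) = real (card Q2) + real (card Q3)"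
        using card_Un_disjoint[OF Q23(3,4,2)] Q23(1) by simp
      \<comment> \<open>Substituting \<open>card H\<close> and \<open>card R\<close> into
        \<open>4/3 * card H - 2/3 * card R + 2 * h\<close> cancels \<open>card Q3\<close> and leaves
        \<open>4/3 * n + 2/3 * h + 2/3 * card Q2 - 2/3\<close>; then \<open>card Q2\<close> is at
        most \<open>h - s\<close>.\<close>
      have "real (card R) = 1 + 2 * real (card Q3) + real (card Q2)"
        "real (card Q2) + real s \<le> real h"
        using cR count by simp_all
      then show "real (size (mset_set (H - F) + (mset_set Z + mset_set Z)))
          \<le> 4 / 3 * (real n + real h) - 2 / 3 * (real s + 1)"
        using F(4) unfolding sz wH cH cQ by (simp add: field_simps)
    qed
  qed
qed

end
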